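(* Let $g>0$ be arbitrary. Assume that $W_\chi\in\mathbb{R}^{\ell\times\ell}$, $R_\chi\in\mathbb{R}^{n\times n}$, $F_{\gamma,\delta}\in\mathbb{R}^{m\times n}$, $G_{\gamma,\delta}\in\mathbb{R}^{n\times n}$ (for $\chi=(\alpha,\beta,\gamma,\delta)\in\mathfrak X$) and numbers $\nu(\gamma,\delta)\ge0$ ($\gamma\in[N]$, $\delta\in[T]$) satisfy $$\begin{bmatrix} R_\chi-\bar\mu(\chi)E_\alpha E_\alpha^\top & A_\alpha G_{\gamma,\delta}+B_\alpha F_{\gamma,\delta}\\ \star & G_{\gamma,\delta}+G_{\gamma,\delta}^\top-\bar{\mathcal D}_\chi(R)\end{bmatrix}>0,\qquad \begin{bmatrix} W_\chi & C_\alpha G_{\gamma,\delta}+D_\alpha F_{\gamma,\delta}\\ \star & G_{\gamma,\delta}+G_{\gamma,\delta}^\top-\bar{\mathcal D}_\chi(R)\end{bmatrix}>0$$ for every $\chi=(\alpha,\beta,\gamma,\delta)\in\mathfrak X$, together with $$\sum_{\chi\in\mathfrak X}\operatorname{tr}(W_\chi)<g,\qquad \sum_{\gamma=1}^N\sum_{\delta=1}^T\nu(\gamma,\delta)=1,$$ where $\bar\mu$ is the initial distribution on $\mathfrak X$ determined by $\mu_r,\mu_s,\nu$ through $\bar\mu(\alpha,\beta,\gamma,\delta)=\mu_r(\alpha)\mu_s(\beta)$ if $f(\beta)=1$ and $\bar\mu(\alpha,\beta,\gamma,\delta)=\mu_r(\alpha)\mu_s(\beta)\nu(\gamma,\delta)$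 otherwise. Define $K_{\gamma,\delta}=F_{\gamma,\delta}G_{\gamma,\delta}^{-1}$ for $\gamma\in[N]$, $\delta\in[T]$. Then the closed-loop system $\Sigma_K$ is mean square stable and, with $\bar r_0$ distributed according to $\bar\mu$, satisfies $\|\Sigma_K\|_2^2<g$.
   Context: Notation. $[N]=\{1,\dots,N\}$; $\mathbb N$ is the set of nonnegative integers; for an integer $k$ and positive integer $T$, $\lfloor k\rfloor_T$ is the unique element of $\{0,\dots,T-1\}$ congruent to $k$ modulo $T$; $\mathbf 1(\cdot)$ is the indicator of a condition; $\|\cdot\|$ is the Euclidean norm; $A>0$ means that $A$ is real symmetric positive definite; $\star$ denotes a block determined by symmetry. Open-loop system. $n,m,q,\ell,N,M,T$ are positive integers. For $i\in[N]$, $A_i\in\mathbb{R}^{n\times n}$, $B_i\in\mathbb{R}^{n\times m}$, $C_i\in\mathbb{R}^{\ell\times n}$, $D_i\in\mathbb{R}^{\ell\times m}$, $E_i\in\mathbb{R}^{n\times q}$. The mode $r=\{r(k)\}_{k\ge0}$ is a time-homogeneous Markov chain on $[N]$ with transition matrix $P=(p_{\alpha\alpha'})$, and $s=\{s(k)\}_{k\ge0}$ is a time-homogeneous Markov chain on $[M]$ with transition matrix $(q_{\beta\beta'})$, independent of $r$. The initial distributions $\mu_r$ of $r_0=r(0)$ and $\mu_s$ of $s_0=s(0)$ are given. The system is $x(k+1)=A_{r(k)}x(k)+B_{r(k)}u(k)+E_{r(k)}w(k)$, $z(k)=C_{r(k)}x(k)+D_{r(k)}u(k)$, with $x(0)=x_0$.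 Observation process. A function $f:[M]\to\{0,1\}$ is given. Observation times: $t_0=\min\{k\ge0: f(s(k))=1\}$, $t_{i+1}=\min\{k>t_i: f(s(k))=1\}$ ($\min\emptyset=\infty$). For $k\ge t_0$, $\tau(k)=\max\{t_i: t_i\le k\}$ and $\sigma(k)=r(\tau(k))$; for $k<t_0$, $\tau(k)=\tau_0$ and $\sigma(k)=\sigma_0$, where $\tau_0$ is an integer with $\tau_0=0$ if $t_0=0$ and $\tau_0<0$ otherwise, and $\sigma_0\in[N]$ with $\sigma_0=r_0$ if $t_0=0$. Put $\rho(k)=\lfloor k-\tau(k)\rfloor_T+1\in[T]$, $\rho_0=\rho(0)$. When $f(s_0)=0$, the pair $(\sigma_0,\rho_0)$ is a design choice, drawn from a distribution $\nu$ on $[N]\times[T]$. Closed loop. Given gains $K_{\gamma,\delta}\in\mathbb{R}^{m\times n}$ ($\gamma\in[N],\delta\in[T]$), the feedback $u(k)=K_{\sigma(k),\rho(k)}x(k)$ gives the closed-loop system $\Sigma_K$: $x(k+1)=(A_{r(k)}+B_{r(k)}K_{\sigma(k),\rho(k)})x(k)+E_{r(k)}w(k)$, $z(k)=(C_{r(k)}+D_{r(k)}K_{\sigma(k),\rho(k)})x(k)$. Let $\bar r(k)=(r(k),s(k),\sigma(k),\rho(k))$, $\bar r_0=\bar r(0)$, and let $\mathfrak X$ be the set of $(\alpha,\beta,\gamma,\delta)\in[N]\times[M]\times[N]\times[T]$ such that $f(\beta)=1$ implies $\alpha=\gamma$ and $\delta=1$; $\bar r$ takes values in $\mathfrak X$.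 Write $z(\cdot;x_0,\bar r_0,w)$ for the output with given initial conditions and disturbance. For pairs $(\gamma,\delta)$ that do not occur as the last two components of any element of $\mathfrak X$, the gain $K_{\gamma,\delta}$ never enters the closed loop and may be taken arbitrary. For $\chi=(\alpha,\beta,\gamma,\delta)$, $\chi'=(\alpha',\beta',\gamma',\delta')$ in $\mathfrak X$ put $\bar p_{\chi\chi'}=\mathbf 1(\alpha'=\gamma',\ \delta'=1)\,p_{\alpha\alpha'}q_{\beta\beta'}$ if $f(\beta')=1$ and $\bar p_{\chi\chi'}=\mathbf 1(\gamma'=\gamma,\ \lfloor\delta'-\delta-1\rfloor_T=0)\,p_{\alpha\alpha'}q_{\beta\beta'}$ otherwise (these are the transition probabilities of $\bar r$). For a family $R=\{R_\chi\}_{\chi\in\mathfrak X}\subset\mathbb{R}^{n\times n}$, $\bar{\mathcal D}_\chi(R)=\sum_{\chi'\in\mathfrak X}\bar p_{\chi'\chi}R_{\chi'}$. Mean square stability of $\Sigma_K$: there exist $C>0$ and $\lambda\in[0,1)$ such that, with $w\equiv0$, $E[\|x(k)\|^2]\le C\lambda^k\|x_0\|^2$ for all $x_0\in\mathbb{R}^n$, all $\bar r_0\in\mathfrak X$ and all $k\ge0$. $H_2$ norm: when $\bar r_0$ has distribution $\bar\mu$ on $\mathfrak X$, $\|\Sigma_K\|_2=\big(\sum_{i=1}^q\sum_{\chi\in\mathfrak X}\bar\mu(\chi)\,\|z(\cdot;0,\chi,e_i\phi)\|_2^2\big)^{1/2}$, where $e_i$ is the $i$th standard unit vector of $\mathbb{R}^q$,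 $\phi(0)=1$, $\phi(k)=0$ for $k\ge1$, and $\|h\|_2^2=\sum_{k=0}^\infty E[\|h(k)\|^2]$. *)

theory Defs
  imports "HOL-Probability.Probability"
begin

text \<open>
  Conventions. The index sets [N] and [M] of the two Markov chains are finite types
  (usually written \<open>'r\<close> and \<open>'s\<close>), and the dimensions n, m, q, l are finite types as well.
  The set [T] is \<open>{1..T}\<close> in type \<^typ>\<open>nat\<close>, since arithmetic modulo T takes place in it.
  The observation function is Boolean, \<open>f \<beta>\<close> standing for f(\<beta>) = 1. A real
  a-by-b matrix has type \<open>real^'b^'a\<close>.
\<close>

section \<open>Matrices\<close>

definition pos_def :: "real^'a^'a \<Rightarrow> bool" where
  "pos_def A \<longleftrightarrow> transpose A = A \<and> (\<forall>x. x \<noteq> 0 \<longrightarrow> 0 < x \<bullet> (A *v x))"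

definition block_matrix ::
    "real^'a^'a \<Rightarrow> real^'b^'a \<Rightarrow> real^'a^'b \<Rightarrow> real^'b^'b \<Rightarrow> real^('a + 'b)^('a + 'b)" where
  "block_matrix A B C D = (\<chi> i j. case i of
       Inl a \<Rightarrow> (case j of Inl a' \<Rightarrow> A $ a $ a' | Inr b \<Rightarrow> B $ a $ b)
     | Inr b \<Rightarrow> (case j of Inl a \<Rightarrow> C $ b $ a | Inr b' \<Rightarrow> D $ b $ b'))"

text \<open>The lower left block is the one usually abbreviated by a star.\<close>

definition sym_block ::
    "real^'a^'a \<Rightarrow> real^'b^'a \<Rightarrow> real^'b^'b \<Rightarrow> real^('a + 'b)^('a + 'b)" where
  "sym_block A B D = block_matrix A B (transpose B) D"

section \<open>Markov chains\<close>

definition stochastic :: "real^'a^'a \<Rightarrow> bool" where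
  "stochastic P \<longleftrightarrow> (\<forall>a b. 0 \<le> P $ a $ b) \<and> (\<forall>a. (\<Sum>b\<in>UNIV. P $ a $ b) = 1)"

definition markov_chain :: "'w measure \<Rightarrow> (nat \<Rightarrow> 'w \<Rightarrow> 'a) \<Rightarrow> real^'a^'a \<Rightarrow> bool" where
  "markov_chain \<Omega> X P \<longleftrightarrow>
     (\<forall>k. X k \<in> measurable \<Omega> (count_space UNIV)) \<and>
     (\<forall>k h b. \<P>(\<omega> in \<Omega>. \<forall>i\<le>k. X i \<omega> = h i) > 0 \<longrightarrow>
        \<P>(\<omega> in \<Omega>. X (Suc k) \<omega> = b \<bar> \<forall>i\<le>k. X i \<omega> = h i) = P $ h k $ b)"

text \<open>
  Independence of the generated sigma-algebras; \<^const>\<open>prob_space.indep_var\<close> would require both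
  processes to have the same type.
\<close>

definition indep_processes ::
    "'w measure \<Rightarrow> (nat \<Rightarrow> 'w \<Rightarrow> 'a) \<Rightarrow> (nat \<Rightarrow> 'w \<Rightarrow> 'b) \<Rightarrow> bool" where
  "indep_processes \<Omega> X Y \<longleftrightarrow>
     prob_space.indep_set \<Omega>
       (sets (vimage_algebra (space \<Omega>) (\<lambda>\<omega> k. X k \<omega>) (PiM UNIV (\<lambda>_. count_space UNIV))))
       (sets (vimage_algebra (space \<Omega>) (\<lambda>\<omega> k. Y k \<omega>) (PiM UNIV (\<lambda>_. count_space UNIV))))"

section \<open>Observation process\<close>

text \<open>
  These definitions are pathwise: \<open>r\<close> and \<open>s\<close> are trajectories of the two chains. The infimum of
  the empty set in \<^typ>\<open>enat\<close> is \<open>\<infinity>\<close>; that of a nonempty set is its minimum.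
\<close>

primrec obs_time :: "('s \<Rightarrow> bool) \<Rightarrow> (nat \<Rightarrow> 's) \<Rightarrow> nat \<Rightarrow> enat" where
  "obs_time f s 0 = Inf {enat k |k. f (s k)}"
| "obs_time f s (Suc i) = Inf {enat k |k. obs_time f s i < enat k \<and> f (s k)}"

definition last_obs :: "('s \<Rightarrow> bool) \<Rightarrow> int \<Rightarrow> (nat \<Rightarrow> 's) \<Rightarrow> nat \<Rightarrow> int" where
  "last_obs f \<tau>0 s k =
     (if enat k < obs_time f s 0 then \<tau>0
      else int (Max {t. t \<le> k \<and> (\<exists>i. obs_time f s i = enat t)}))"

definition obs_mode ::
    "('s \<Rightarrow> bool) \<Rightarrow> int \<Rightarrow> 'r \<Rightarrow> (nat \<Rightarrow> 'r) \<Rightarrow> (nat \<Rightarrow> 's) \<Rightarrow> nat \<Rightarrow> 'r" where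
  "obs_mode f \<tau>0 \<sigma>0 r s k =
     (if enat k < obs_time f s 0 then \<sigma>0 else r (nat (last_obs f \<tau>0 s k)))"

definition obs_age :: "('s \<Rightarrow> bool) \<Rightarrow> nat \<Rightarrow> int \<Rightarrow> (nat \<Rightarrow> 's) \<Rightarrow> nat \<Rightarrow> nat" where
  "obs_age f T \<tau>0 s k = nat ((int k - last_obs f \<tau>0 s k) mod int T) + 1"

section \<open>The extended chain\<close>

type_synonym ('r, 's) ext_mode = "'r \<times> 's \<times> 'r \<times> nat"

definition ext_modes :: "('s \<Rightarrow> bool) \<Rightarrow> nat \<Rightarrow> ('r, 's) ext_mode set" where
  "ext_modes f T =
     {(\<alpha>, \<beta>, \<gamma>, \<delta>). \<delta> \<in> {1..T} \<and> (f \<beta> \<longrightarrow> \<alpha> = \<gamma> \<and> \<delta> = 1)}"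

fun ext_trans ::
    "('s \<Rightarrow> bool) \<Rightarrow> nat \<Rightarrow> real^'r^'r \<Rightarrow> real^'s^'s \<Rightarrow> ('r, 's) ext_mode \<Rightarrow> ('r, 's) ext_mode \<Rightarrow> real"
where
  "ext_trans f T P Q (\<alpha>, \<beta>, \<gamma>, \<delta>) (\<alpha>', \<beta>', \<gamma>', \<delta>') =
     (if f \<beta>'
      then of_bool (\<alpha>' = \<gamma>' \<and> \<delta>' = 1) * P $ \<alpha> $ \<alpha>' * Q $ \<beta> $ \<beta>'
      else of_bool (\<gamma>' = \<gamma> \<and> (int \<delta>' - int \<delta> - 1) mod int T = 0) * P $ \<alpha> $ \<alpha>' * Q $ \<beta> $ \<beta>')"

definition ext_D ::
    "('s \<Rightarrow> bool) \<Rightarrow> nat \<Rightarrow> real^'r^'r \<Rightarrow> real^'s^'s \<Rightarrow>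
     (('r, 's) ext_mode \<Rightarrow> real^'n^'n) \<Rightarrow> ('r, 's) ext_mode \<Rightarrow> real^'n^'n" where
  "ext_D f T P Q R c = (\<Sum>c'\<in>ext_modes f T. ext_trans f T P Q c' c *\<^sub>R R c')"

fun ext_init ::
    "('s \<Rightarrow> bool) \<Rightarrow> 'r pmf \<Rightarrow> 's pmf \<Rightarrow> ('r \<Rightarrow> nat \<Rightarrow> real) \<Rightarrow> ('r, 's) ext_mode \<Rightarrow> real" where
  "ext_init f \<mu>r \<mu>s \<nu> (\<alpha>, \<beta>, \<gamma>, \<delta>) =
     (if f \<beta> then pmf \<mu>r \<alpha> * pmf \<mu>s \<beta> else pmf \<mu>r \<alpha> * pmf \<mu>s \<beta> * \<nu> \<gamma> \<delta>)"

section \<open>Realizations\<close>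

text \<open>
  \<open>\<Omega>\<close> is the law of the two chains when the extended chain starts in the given state
  (\<alpha>, \<beta>, \<gamma>, \<delta>). The integer \<open>\<tau>0\<close> is any admissible time of the last observation before
  time 0 whose residue gives \<delta> as the initial age; the admissible choices all lead to the same
  closed loop.
\<close>

fun realization ::
    "('s \<Rightarrow> bool) \<Rightarrow> nat \<Rightarrow> real^'r^'r \<Rightarrow> real^'s^'s \<Rightarrow> 'w measure \<Rightarrow>
     (nat \<Rightarrow> 'w \<Rightarrow> 'r) \<Rightarrow> (nat \<Rightarrow> 'w \<Rightarrow> 's) \<Rightarrow> int \<Rightarrow> ('r, 's) ext_mode \<Rightarrow> bool" where
  "realization f T P Q \<Omega> r s \<tau>0 (\<alpha>, \<beta>, \<gamma>, \<delta>) \<longleftrightarrow>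
     prob_space \<Omega> \<and>
     markov_chain \<Omega> r P \<and> (AE \<omega> in \<Omega>. r 0 \<omega> = \<alpha>) \<and>
     markov_chain \<Omega> s Q \<and> (AE \<omega> in \<Omega>. s 0 \<omega> = \<beta>) \<and>
     indep_processes \<Omega> r s \<and>
     (if f \<beta> then \<tau>0 = 0 else \<tau>0 < 0) \<and> nat ((- \<tau>0) mod int T) + 1 = \<delta>"

section \<open>Closed loop\<close>

text \<open>Pathwise: \<open>a\<close>, \<open>\<sigma>\<close>, \<open>\<rho>\<close> are trajectories of the mode, the observed mode and the age.\<close>

primrec loop_state ::
    "('r \<Rightarrow> real^'n^'n) \<Rightarrow> ('r \<Rightarrow> real^'m^'n) \<Rightarrow> ('r \<Rightarrow> real^'q^'n) \<Rightarrow> ('r \<Rightarrow> nat \<Rightarrow> real^'n^'m) \<Rightarrow>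
     (nat \<Rightarrow> 'r) \<Rightarrow> (nat \<Rightarrow> 'r) \<Rightarrow> (nat \<Rightarrow> nat) \<Rightarrow> real^'n \<Rightarrow> (nat \<Rightarrow> real^'q) \<Rightarrow> nat \<Rightarrow> real^'n" where
  "loop_state A B E K a \<sigma> \<rho> x0 w 0 = x0"
| "loop_state A B E K a \<sigma> \<rho> x0 w (Suc k) =
     (A (a k) + B (a k) ** K (\<sigma> k) (\<rho> k)) *v loop_state A B E K a \<sigma> \<rho> x0 w k + E (a k) *v w k"

text \<open>
  In the following, \<open>\<tau>0\<close> assigns to each initial state of the extended chain the time of the
  last observation, and \<open>Pr\<close> the corresponding law on the sample space.
\<close>

fun cl_state ::
    "('r \<Rightarrow> real^'n^'n) \<Rightarrow> ('r \<Rightarrow> real^'m^'n) \<Rightarrow> ('r \<Rightarrow> real^'q^'n) \<Rightarrow> ('r \<Rightarrow> nat \<Rightarrow> real^'n^'m) \<Rightarrow>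
     ('s \<Rightarrow> bool) \<Rightarrow> nat \<Rightarrow> (nat \<Rightarrow> 'w \<Rightarrow> 'r) \<Rightarrow> (nat \<Rightarrow> 'w \<Rightarrow> 's) \<Rightarrow> (('r, 's) ext_mode \<Rightarrow> int) \<Rightarrow>
     real^'n \<Rightarrow> ('r, 's) ext_mode \<Rightarrow> (nat \<Rightarrow> real^'q) \<Rightarrow> nat \<Rightarrow> 'w \<Rightarrow> real^'n" where
  "cl_state A B E K f T r s \<tau>0 x0 (\<alpha>, \<beta>, \<gamma>, \<delta>) w k \<omega> =
     loop_state A B E K
       (\<lambda>j. r j \<omega>)
       (obs_mode f (\<tau>0 (\<alpha>, \<beta>, \<gamma>, \<delta>)) \<gamma> (\<lambda>j. r j \<omega>) (\<lambda>j. s j \<omega>))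
       (obs_age f T (\<tau>0 (\<alpha>, \<beta>, \<gamma>, \<delta>)) (\<lambda>j. s j \<omega>))
       x0 w k"

fun cl_output ::
    "('r \<Rightarrow> real^'n^'n) \<Rightarrow> ('r \<Rightarrow> real^'m^'n) \<Rightarrow> ('r \<Rightarrow> real^'n^'l) \<Rightarrow> ('r \<Rightarrow> real^'m^'l) \<Rightarrow>
     ('r \<Rightarrow> real^'q^'n) \<Rightarrow> ('r \<Rightarrow> nat \<Rightarrow> real^'n^'m) \<Rightarrow>
     ('s \<Rightarrow> bool) \<Rightarrow> nat \<Rightarrow> (nat \<Rightarrow> 'w \<Rightarrow> 'r) \<Rightarrow> (nat \<Rightarrow> 'w \<Rightarrow> 's) \<Rightarrow> (('r, 's) ext_mode \<Rightarrow> int) \<Rightarrow>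
     real^'n \<Rightarrow> ('r, 's) ext_mode \<Rightarrow> (nat \<Rightarrow> real^'q) \<Rightarrow> nat \<Rightarrow> 'w \<Rightarrow> real^'l" where
  "cl_output A B C D E K f T r s \<tau>0 x0 (\<alpha>, \<beta>, \<gamma>, \<delta>) w k \<omega> =
     (C (r k \<omega>) + D (r k \<omega>) **
        K (obs_mode f (\<tau>0 (\<alpha>, \<beta>, \<gamma>, \<delta>)) \<gamma> (\<lambda>j. r j \<omega>) (\<lambda>j. s j \<omega>) k)
          (obs_age f T (\<tau>0 (\<alpha>, \<beta>, \<gamma>, \<delta>)) (\<lambda>j. s j \<omega>) k))
     *v cl_state A B E K f T r s \<tau>0 x0 (\<alpha>, \<beta>, \<gamma>, \<delta>) w k \<omega>"

definition mean_square :: "'w measure \<Rightarrow> ('w \<Rightarrow> 'v::real_normed_vector) \<Rightarrow> ennreal" where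
  "mean_square \<Omega> h = (\<integral>\<^sup>+ \<omega>. ennreal ((norm (h \<omega>))\<^sup>2) \<partial>\<Omega>)"

definition mean_square_stable ::
    "('r \<Rightarrow> real^'n^'n) \<Rightarrow> ('r \<Rightarrow> real^'m^'n) \<Rightarrow> ('r \<Rightarrow> real^'q^'n) \<Rightarrow> ('r \<Rightarrow> nat \<Rightarrow> real^'n^'m) \<Rightarrow>
     ('s \<Rightarrow> bool) \<Rightarrow> nat \<Rightarrow> (('r, 's) ext_mode \<Rightarrow> 'w measure) \<Rightarrow>
     (nat \<Rightarrow> 'w \<Rightarrow> 'r) \<Rightarrow> (nat \<Rightarrow> 'w \<Rightarrow> 's) \<Rightarrow> (('r, 's) ext_mode \<Rightarrow> int) \<Rightarrow> bool" where
  "mean_square_stable A B E K f T Pr r s \<tau>0 \<longleftrightarrow>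
     (\<exists>C > 0. \<exists>\<kappa>\<in>{0..<1}. \<forall>x0. \<forall>c\<in>ext_modes f T. \<forall>k.
        mean_square (Pr c) (cl_state A B E K f T r s \<tau>0 x0 c (\<lambda>_. 0) k)
          \<le> ennreal (C * \<kappa> ^ k * (norm x0)\<^sup>2))"

text \<open>The \<open>H\<^sub>2\<close> norm is extended real valued, so that it is \<open>\<infinity>\<close> if the series diverges.\<close>

definition ennreal_sqrt :: "ennreal \<Rightarrow> ennreal" where
  "ennreal_sqrt x = (if x = \<infinity> then \<infinity> else ennreal (sqrt (enn2real x)))"

definition l2_norm :: "'w measure \<Rightarrow> (nat \<Rightarrow> 'w \<Rightarrow> 'v::real_normed_vector) \<Rightarrow> ennreal" where
  "l2_norm \<Omega> h = ennreal_sqrt (\<Sum>k. mean_square \<Omega> (h k))"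

definition unit_impulse :: "'q \<Rightarrow> nat \<Rightarrow> real^'q" where
  "unit_impulse i k = (if k = 0 then axis i 1 else 0)"

definition H2_norm ::
    "('r \<Rightarrow> real^'n^'n) \<Rightarrow> ('r \<Rightarrow> real^'m^'n) \<Rightarrow> ('r \<Rightarrow> real^'n^'l) \<Rightarrow> ('r \<Rightarrow> real^'m^'l) \<Rightarrow>
     ('r \<Rightarrow> real^'q^'n) \<Rightarrow> ('r \<Rightarrow> nat \<Rightarrow> real^'n^'m) \<Rightarrow>
     ('s \<Rightarrow> bool) \<Rightarrow> nat \<Rightarrow> (('r, 's) ext_mode \<Rightarrow> 'w measure) \<Rightarrow>
     (nat \<Rightarrow> 'w \<Rightarrow> 'r) \<Rightarrow> (nat \<Rightarrow> 'w \<Rightarrow> 's) \<Rightarrow> (('r, 's) ext_mode \<Rightarrow> int) \<Rightarrow>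
     (('r, 's) ext_mode \<Rightarrow> real) \<Rightarrow> ennreal" where
  "H2_norm A B C D E K f T Pr r s \<tau>0 \<mu> =
     ennreal_sqrt (\<Sum>i\<in>UNIV. \<Sum>c\<in>ext_modes f T. ennreal (\<mu> c) *
       (l2_norm (Pr c) (cl_output A B C D E K f T r s \<tau>0 0 c (unit_impulse i)))\<^sup>2)"

end

theory Submission
  imports Defs
begin

text \<open>
  The extended mode is a Markov chain, because it is updated from its previous value by the new
  values of the two independent chains. Consider the quadratic forms u \<mapsto> E[(u \<bullet> x(k+1))^2; mode(k) = \<chi>].
  Under the closed loop without disturbance they are propagated by the linear monotone operator
  that replaces S by u \<mapsto> \<Sum>\<chi>'. p(\<chi>', \<chi>) S(\<chi>')(v), where v is the transposed closed-loop matrix of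
  \<chi> applied to u. The first matrix inequality says that R exceeds its image under this operator by
  more than the forcing term \<mu>(\<chi>) E E^T of the impulse. Without the forcing term the operator
  therefore contracts with respect to R, which gives stability; with it, R bounds the sum over all
  times of the forms generated by the impulse. The second inequality then bounds the output energy
  by the sum of the traces of W.
\<close>

section \<open>Trajectories of the extended chain\<close>

lemma enat_Inf_mem: "A \<noteq> {} \<Longrightarrow> Inf A \<in> (A :: enat set)"
  unfolding Inf_enat_def by (auto intro: LeastI)

text \<open>Both clauses of \<open>obs_time\<close> are infima of sets of observed times. A finite
  infimum means that the set is nonempty, and in \<open>enat\<close> it is then attained.\<close>

lemma obs_time_observed:
  assumes "obs_time f s i = enat t"
  shows "f (s t)"
proof -
  obtain p where p: "obs_time f s i = Inf {enat k |k. p k \<and> f (s k)}"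
  proof (cases i)
    case 0
    show ?thesis by (rule that[of "\<lambda>_. True"]) (simp add: 0)
  next
    case (Suc j)
    show ?thesis by (rule that[of "\<lambda>k. obs_time f s j < enat k"]) (simp add: Suc)
  qed
  then have "{enat k |k. p k \<and> f (s k)} \<noteq> {}"
    using assms by (auto simp: Inf_enat_def split: if_splits)
  from enat_Inf_mem[OF this] show ?thesis using p assms by auto
qed

text \<open>Successive observation times increase strictly as long as they are finite. The bound
  prevents infinitely many of them from lying below a fixed time.\<close>

lemma obs_time_ge: "enat i \<le> obs_time f s i"
proof (induction i)
  case 0
  show ?case by (simp flip: zero_enat_def)
next
  case (Suc i)
  have "enat (Suc i) \<le> x" if "obs_time f s i < x" for x
    using le_less_trans[OF Suc that] by (metis Suc_ile_eq)
  then show ?case by (auto intro!: Inf_greatest)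
qed

text \<open>If an observed time \<open>t\<close> were skipped, it would remain a candidate for every
  infimum, so all \<open>obs_time f s i\<close> would stay below \<open>t\<close>. For
  \<open>i = t\<close> this contradicts \<open>obs_time_ge\<close>.\<close>

lemma ex_obs_time_iff: "(\<exists>i. obs_time f s i = enat t) \<longleftrightarrow> f (s t)"
proof
  assume t: "f (s t)"
  show "\<exists>i. obs_time f s i = enat t"
  proof (rule ccontr)
    assume n: "\<nexists>i. obs_time f s i = enat t"
    have "obs_time f s i < enat t" for i
    proof (induction i)
      case 0
      have "obs_time f s 0 \<le> enat t" using t by (auto intro!: Inf_lower)
      then show ?case using n by (metis order_le_less)
    next
      case (Suc i)
      then have "obs_time f s (Suc i) \<le> enat t" using t by (auto intro!: Inf_lower)
      then show ?case using n by (metis order_le_less)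
    qed
    from this[of t] show False using obs_time_ge[of t f s] by simp
  qed
qed (auto dest: obs_time_observed)

lemma less_first_obs_time_iff: "enat k < obs_time f s 0 \<longleftrightarrow> (\<forall>t\<le>k. \<not> f (s t))"
proof
  assume k: "enat k < obs_time f s 0"
  show "\<forall>t\<le>k. \<not> f (s t)"
  proof (intro allI impI notI)
    fix t assume "t \<le> k" "f (s t)"
    then have "obs_time f s 0 \<le> enat t" by (auto intro!: Inf_lower)
    then show False using k \<open>t \<le> k\<close> by (meson enat_ord_simps(1) leD order_trans)
  qed
next
  assume "\<forall>t\<le>k. \<not> f (s t)"
  then have "enat (Suc k) \<le> obs_time f s 0"
    by (auto intro!: Inf_greatest simp: not_less_eq_eq)
  then show "enat k < obs_time f s 0" by (simp add: Suc_ile_eq)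
qed

lemma last_obs_eq:
  "last_obs f \<tau>0 s k = (if \<forall>t\<le>k. \<not> f (s t) then \<tau>0 else int (Max {t. t \<le> k \<and> f (s t)}))"
  unfolding last_obs_def less_first_obs_time_iff ex_obs_time_iff ..

lemma last_obs_0: "last_obs f \<tau>0 s 0 = (if f (s 0) then 0 else \<tau>0)"
proof -
  have "f (s 0) \<Longrightarrow> {t. t = 0 \<and> f (s t)} = {0}" by auto
  then show ?thesis by (simp add: last_obs_eq)
qed

lemma last_obs_Suc:
  "last_obs f \<tau>0 s (Suc k) = (if f (s (Suc k)) then int (Suc k) else last_obs f \<tau>0 s k)"
proof (cases "f (s (Suc k))")
  case True
  then have "Max {t. t \<le> Suc k \<and> f (s t)} = Suc k" by (intro Max_eqI) auto
  with True show ?thesis by (auto simp: last_obs_eq)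
next
  case False
  then have "(t \<le> Suc k \<and> f (s t)) = (t \<le> k \<and> f (s t))" for t
    by (auto simp: le_Suc_eq)
  moreover from this have "(\<forall>t\<le>Suc k. \<not> f (s t)) = (\<forall>t\<le>k. \<not> f (s t))" by blast
  ultimately show ?thesis using False by (auto simp: last_obs_eq)
qed

lemma obs_mode_0: "obs_mode f \<tau>0 \<sigma>0 r s 0 = (if f (s 0) then r 0 else \<sigma>0)"
  unfolding obs_mode_def less_first_obs_time_iff last_obs_0 by simp

lemma obs_mode_Suc:
  "obs_mode f \<tau>0 \<sigma>0 r s (Suc k) = (if f (s (Suc k)) then r (Suc k) else obs_mode f \<tau>0 \<sigma>0 r s k)"
  unfolding obs_mode_def less_first_obs_time_iff last_obs_Suc
  by (auto simp: le_Suc_eq nat_add_distrib)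

lemma obs_age_0:
  "obs_age f T \<tau>0 s 0 = (if f (s 0) then 1 else nat ((- \<tau>0) mod int T) + 1)"
  by (simp add: obs_age_def last_obs_0)

text \<open>An age is a residue plus one. Hence \<open>\<delta> mod T\<close> is the residue one
  step later, and the successor of age \<open>T\<close> is 1.\<close>

lemma obs_age_Suc:
  assumes "T > 0"
  shows "obs_age f T \<tau>0 s (Suc k) = (if f (s (Suc k)) then 1 else obs_age f T \<tau>0 s k mod T + 1)"
proof -
  define d where "d = int k - last_obs f \<tau>0 s k"
  have "int ((nat (d mod int T) + 1) mod T) = (d + 1) mod int T"
    using assms by (simp add: zmod_int mod_simps add.commute)
  then have "nat ((d + 1) mod int T) = (nat (d mod int T) + 1) mod T"
    by (metis nat_int)
  moreover have "int (Suc k) - last_obs f \<tau>0 s k = d + 1" by (simp add: d_def)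
  ultimately show ?thesis
    unfolding obs_age_def last_obs_Suc d_def[symmetric] by (simp only: diff_self split: if_split) simp
qed

section \<open>The extended mode as a deterministic recursion along the two paths\<close>

fun ext_step :: "('s \<Rightarrow> bool) \<Rightarrow> nat \<Rightarrow> ('r, 's) ext_mode \<Rightarrow> 'r \<Rightarrow> 's \<Rightarrow> ('r, 's) ext_mode" where
  "ext_step f T (\<alpha>, \<beta>, \<gamma>, \<delta>) \<alpha>' \<beta>' =
     (if f \<beta>' then (\<alpha>', \<beta>', \<alpha>', 1) else (\<alpha>', \<beta>', \<gamma>, \<delta> mod T + 1))"

text \<open>The path starts in \<open>c\<close> whatever \<open>a 0\<close> and \<open>b 0\<close>
  are. This keeps it inside \<open>ext_modes\<close> on every sample point, although the chains have
  the prescribed initial values only almost surely.\<close>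

primrec ext_path ::
    "('s \<Rightarrow> bool) \<Rightarrow> nat \<Rightarrow> ('r, 's) ext_mode \<Rightarrow> (nat \<Rightarrow> 'r) \<Rightarrow> (nat \<Rightarrow> 's) \<Rightarrow> nat \<Rightarrow> ('r, 's) ext_mode"
where
  "ext_path f T c a b 0 = c"
| "ext_path f T c a b (Suc k) = ext_step f T (ext_path f T c a b k) (a (Suc k)) (b (Suc k))"

lemma ext_step_in:
  assumes "T > 0" shows "ext_step f T c \<alpha> \<beta> \<in> ext_modes f T"
  using assms by (cases c) (auto simp: ext_modes_def Suc_le_eq)

lemma ext_path_in:
  assumes "T > 0" "c \<in> ext_modes f T" shows "ext_path f T c a b k \<in> ext_modes f T"
  using assms by (cases k) (auto intro: ext_step_in)

lemma ext_path_cong: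
  assumes "\<And>i. i \<le> k \<Longrightarrow> a i = a' i" "\<And>i. i \<le> k \<Longrightarrow> b i = b' i"
  shows "ext_path f T c a b k = ext_path f T c a' b' k"
  using assms by (induction k) auto

text \<open>The time \<open>\<tau>0\<close> enters only through its residue. If time 0 is observed,
  membership of the initial mode in \<open>ext_modes\<close> makes the stored mode and age agree
  with the observed ones.\<close>

lemma ext_path_eq_obs:
  assumes "T > 0" and c: "(\<alpha>, \<beta>, \<gamma>, \<delta>) \<in> ext_modes f T" and "a 0 = \<alpha>" "b 0 = \<beta>"
    and "nat ((- \<tau>0) mod int T) + 1 = \<delta>"
  shows "ext_path f T (\<alpha>, \<beta>, \<gamma>, \<delta>) a b k =
           (a k, b k, obs_mode f \<tau>0 \<gamma> a b k, obs_age f T \<tau>0 b k)"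
proof (induction k)
  case 0
  show ?case using assms by (auto simp: obs_mode_0 obs_age_0 ext_modes_def)
next
  case (Suc k)
  then show ?case using assms(1) by (simp add: obs_mode_Suc obs_age_Suc)
qed

lemma age_succ_iff:
  assumes "T > 0" "\<delta>' \<in> {1..T}"
  shows "(int \<delta>' - int \<delta> - 1) mod int T = 0 \<longleftrightarrow> \<delta>' = \<delta> mod T + 1"
proof -
  obtain d where d: "\<delta>' = Suc d" "d < T" using assms by (cases \<delta>') auto
  have "(int \<delta>' - int \<delta> - 1) mod int T = 0 \<longleftrightarrow> int d mod int T = int \<delta> mod int T"
    by (simp only: mod_eq_dvd_iff dvd_eq_mod_eq_0) (simp add: d)
  also have "\<dots> \<longleftrightarrow> d mod T = \<delta> mod T" by (metis of_nat_eq_iff zmod_int)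
  finally show ?thesis using d by auto
qed

text \<open>Among the ages in \<open>{1..T}\<close> the congruence in \<open>ext_trans\<close>
  selects exactly the one produced by \<open>ext_step\<close>. The transition probability thus
  splits into an indicator of a deterministic update and the probabilities of the two independent
  moves.\<close>

lemma ext_trans_eq:
  assumes "T > 0" "(\<alpha>', \<beta>', \<gamma>', \<delta>') \<in> ext_modes f T"
  shows "ext_trans f T P Q c (\<alpha>', \<beta>', \<gamma>', \<delta>') =
    of_bool (ext_step f T c \<alpha>' \<beta>' = (\<alpha>', \<beta>', \<gamma>', \<delta>')) * (P $ fst c $ \<alpha>' * Q $ fst (snd c) $ \<beta>')"
proof (cases c)
  case (fields \<alpha> \<beta> \<gamma> \<delta>)
  have "\<delta>' \<in> {1..T}" using assms by (auto simp: ext_modes_def)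
  then show ?thesis using age_succ_iff[OF assms(1), of \<delta>' \<delta>] by (auto simp: fields)
qed

section \<open>One step of two independent Markov chains\<close>

definition prefix_event :: "'w measure \<Rightarrow> (nat \<Rightarrow> 'w \<Rightarrow> 'a) \<Rightarrow> nat \<Rightarrow> (nat \<Rightarrow> 'a) \<Rightarrow> 'w set" where
  "prefix_event \<Omega> X k h = {\<omega> \<in> space \<Omega>. \<forall>i\<le>k. X i \<omega> = h i}"

lemma prefix_event_in_sets:
  assumes "markov_chain \<Omega> X P"
  shows "prefix_event \<Omega> X k h \<in> sets \<Omega>"
proof -
  have [measurable]: "X i \<in> measurable \<Omega> (count_space UNIV)" for i
    using assms by (auto simp: markov_chain_def)
  show ?thesis unfolding prefix_event_def by measurable
qed

lemma prefix_event_in_generated: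
  "prefix_event \<Omega> X k h \<in>
     sets (vimage_algebra (space \<Omega>) (\<lambda>\<omega> k. X k \<omega>) (PiM UNIV (\<lambda>_. count_space UNIV)))"
proof -
  have "{x \<in> space (PiM UNIV (\<lambda>_. count_space UNIV)). \<forall>i\<le>k. x i = h i} \<in>
          sets (PiM (UNIV :: nat set) (\<lambda>_. count_space UNIV))"
    by measurable
  from in_vimage_algebra[OF this, of "\<lambda>\<omega> k. X k \<omega>" "space \<Omega>"] show ?thesis
    by (rule back_subst[where P = "\<lambda>S. S \<in> _"]) (auto simp: prefix_event_def space_PiM)
qed

lemma (in prob_space) prefix_event_Suc:
  assumes "markov_chain M X P"
  shows "prob (prefix_event M X (Suc k) h) = prob (prefix_event M X k h) * P $ h k $ h (Suc k)"
proof -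
  have eq: "prefix_event M X (Suc k) h =
      {\<omega> \<in> space M. X (Suc k) \<omega> = h (Suc k) \<and> (\<forall>i\<le>k. X i \<omega> = h i)}"
    by (auto simp: prefix_event_def le_Suc_eq)
  show ?thesis
  \<comment> \<open>\<open>markov_chain\<close> constrains only prefixes of positive probability.
    Extending a null prefix gives a null event, so both sides vanish in the first case.\<close>
  proof (cases "prob (prefix_event M X k h) = 0")
    case True
    have "prob (prefix_event M X (Suc k) h) \<le> prob (prefix_event M X k h)"
      by (intro finite_measure_mono prefix_event_in_sets[OF assms]) (auto simp: prefix_event_def)
    then show ?thesis using True measure_nonneg[of M "prefix_event M X (Suc k) h"] by simp
  next
    case False
    then have pos: "prob {\<omega> \<in> space M. \<forall>i\<le>k. X i \<omega> = h i} > 0"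
      by (simp add: prefix_event_def zero_less_measure_iff)
    then have "\<P>(\<omega> in M. X (Suc k) \<omega> = h (Suc k) \<bar> \<forall>i\<le>k. X i \<omega> = h i) = P $ h k $ h (Suc k)"
      using assms by (simp add: markov_chain_def)
    then show ?thesis using pos unfolding cond_prob_def eq
      by (simp add: prefix_event_def field_simps)
  qed
qed

lemma (in prob_space) prefix_event_Int:
  assumes "indep_processes M X Y"
  shows "prob (prefix_event M X k h \<inter> prefix_event M Y k h') =
    prob (prefix_event M X k h) * prob (prefix_event M Y k h')"
  using assms unfolding indep_processes_def
  by (rule indep_setD) (rule prefix_event_in_generated)+

text \<open>This replaces measurability with respect to the history up to time \<open>k\<close>: on
  finite state spaces, depending on finitely many coordinates is all that is required.\<close>

definition prefix_determined :: "nat \<Rightarrow> ((nat \<Rightarrow> 'a) \<Rightarrow> (nat \<Rightarrow> 'b) \<Rightarrow> 'c) \<Rightarrow> bool" where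
  "prefix_determined k h \<longleftrightarrow>
     (\<forall>a a' b b'. (\<forall>i\<le>k. a i = a' i) \<longrightarrow> (\<forall>i\<le>k. b i = b' i) \<longrightarrow> h a b = h a' b')"

text \<open>\<open>PiE\<close> fixes the values beyond \<open>k\<close>, so each pair of histories
  has exactly one representative and the set is finite.\<close>

definition prefix_pairs :: "nat \<Rightarrow> ((nat \<Rightarrow> 'r) \<times> (nat \<Rightarrow> 's)) set" where
  "prefix_pairs k = PiE {..k} (\<lambda>_. UNIV) \<times> PiE {..k} (\<lambda>_. UNIV)"

lemma finite_prefix_pairs: "finite (prefix_pairs k :: ((nat \<Rightarrow> 'r::finite) \<times> (nat \<Rightarrow> 's::finite)) set)"
  unfolding prefix_pairs_def by (intro finite_cartesian_product finite_PiE) auto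

text \<open>The prefix events partition the sample space. At a given point only the pair of
  restricted paths contributes, which turns every function of the history into a finite combination
  of indicators.\<close>

lemma prefix_expansion:
  fixes X :: "nat \<Rightarrow> 'w \<Rightarrow> 'r::finite" and Y :: "nat \<Rightarrow> 'w \<Rightarrow> 's::finite"
    and h :: "(nat \<Rightarrow> 'r) \<Rightarrow> (nat \<Rightarrow> 's) \<Rightarrow> real"
  assumes h: "prefix_determined k h" and \<omega>: "\<omega> \<in> space \<Omega>"
  shows "h (\<lambda>i. X i \<omega>) (\<lambda>i. Y i \<omega>) =
    (\<Sum>p\<in>prefix_pairs k. h (fst p) (snd p) *
       indicator (prefix_event \<Omega> X k (fst p) \<inter> prefix_event \<Omega> Y k (snd p)) \<omega>)"
proof -
  let ?q = "(restrict (\<lambda>i. X i \<omega>) {..k}, restrict (\<lambda>i. Y i \<omega>) {..k})"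
  have q: "?q \<in> prefix_pairs k" by (auto simp: prefix_pairs_def)
  have "\<omega> \<in> prefix_event \<Omega> X k (fst p) \<inter> prefix_event \<Omega> Y k (snd p) \<longleftrightarrow> ?q = p"
    if "p \<in> prefix_pairs k" for p
    using that \<omega>
    by (cases p) (auto simp: prefix_pairs_def prefix_event_def PiE_def extensional_def fun_eq_iff)
  then have "(\<Sum>p\<in>prefix_pairs k. h (fst p) (snd p) *
       indicator (prefix_event \<Omega> X k (fst p) \<inter> prefix_event \<Omega> Y k (snd p)) \<omega>) =
      (\<Sum>p\<in>prefix_pairs k. if ?q = p then h (fst p) (snd p) else 0)"
    by (intro sum.cong) (auto simp: indicator_def)
  also have "\<dots> = h (fst ?q) (snd ?q)" using q by (simp add: finite_prefix_pairs)
  also have "\<dots> = h (\<lambda>i. X i \<omega>) (\<lambda>i. Y i \<omega>)"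
    by (rule h[unfolded prefix_determined_def, rule_format]) simp_all
  finally show ?thesis ..
qed

lemma (in prob_space) integrable_prefix_determined:
  fixes X :: "nat \<Rightarrow> 'a \<Rightarrow> 'r::finite" and Y :: "nat \<Rightarrow> 'a \<Rightarrow> 's::finite"
    and h :: "(nat \<Rightarrow> 'r) \<Rightarrow> (nat \<Rightarrow> 's) \<Rightarrow> real"
  assumes X: "markov_chain M X P" and Y: "markov_chain M Y Q" and h: "prefix_determined k h"
  shows "integrable M (\<lambda>\<omega>. h (\<lambda>i. X i \<omega>) (\<lambda>i. Y i \<omega>))"
proof -
  have "integrable M (\<lambda>\<omega>. \<Sum>p\<in>prefix_pairs k. h (fst p) (snd p) *
       indicator (prefix_event M X k (fst p) \<inter> prefix_event M Y k (snd p)) \<omega>)"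
    using prefix_event_in_sets[OF X] prefix_event_in_sets[OF Y]
    by (intro Bochner_Integration.integrable_sum integrable_mult_right integrable_real_indicator)
      (auto simp: emeasure_eq_measure)
  then show ?thesis
    by (rule iffD1[OF Bochner_Integration.integrable_cong[OF refl], rotated]) (rule prefix_expansion[OF h, symmetric])
qed

text \<open>The joint Markov property: under the expectation, the indicator of the next values may
  be replaced by transition probabilities. By independence it suffices to check this on the prefix
  events of each chain.\<close>

lemma (in prob_space) expectation_markov_step:
  fixes X :: "nat \<Rightarrow> 'a \<Rightarrow> 'r::finite" and Y :: "nat \<Rightarrow> 'a \<Rightarrow> 's::finite"
    and h :: "(nat \<Rightarrow> 'r) \<Rightarrow> (nat \<Rightarrow> 's) \<Rightarrow> real"
  assumes X: "markov_chain M X P" and Y: "markov_chain M Y Q" and ind: "indep_processes M X Y"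
    and h: "prefix_determined k h"
  shows "expectation (\<lambda>\<omega>. h (\<lambda>i. X i \<omega>) (\<lambda>i. Y i \<omega>) * of_bool (X (Suc k) \<omega> = \<alpha> \<and> Y (Suc k) \<omega> = \<beta>)) =
    expectation (\<lambda>\<omega>. h (\<lambda>i. X i \<omega>) (\<lambda>i. Y i \<omega>) * (P $ X k \<omega> $ \<alpha> * Q $ Y k \<omega> $ \<beta>))"
proof -
  define I where "I p = prefix_event M X k (fst p) \<inter> prefix_event M Y k (snd p)" for p
  \<comment> \<open>\<open>J p\<close> is the part of \<open>I p\<close> on which the next values
    are \<open>\<alpha>\<close> and \<open>\<beta>\<close>, written as a longer prefix so that
    \<open>prefix_event_Suc\<close> applies.\<close>
  define J where "J p = prefix_event M X (Suc k) ((fst p)(Suc k := \<alpha>)) \<inter>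
    prefix_event M Y (Suc k) ((snd p)(Suc k := \<beta>))" for p
  have sets: "I p \<in> sets M" "J p \<in> sets M" for p
    using prefix_event_in_sets[OF X] prefix_event_in_sets[OF Y] by (auto simp: I_def J_def)
  have prob_J: "prob (J p) = prob (I p) * (P $ fst p k $ \<alpha> * Q $ snd p k $ \<beta>)" for p
  proof -
    have "prefix_event M X k ((fst p)(Suc k := \<alpha>)) = prefix_event M X k (fst p)"
      "prefix_event M Y k ((snd p)(Suc k := \<beta>)) = prefix_event M Y k (snd p)"
      by (auto simp: prefix_event_def)
    then show ?thesis
      by (simp add: I_def J_def prefix_event_Int[OF ind] prefix_event_Suc[OF X]
          prefix_event_Suc[OF Y])
  qed
  have expect_sum: "expectation (\<lambda>\<omega>. \<Sum>p\<in>prefix_pairs k. u p * indicator (S p) \<omega>) =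
      (\<Sum>p\<in>prefix_pairs k. u p * prob (S p))"
    if "\<And>p. S p \<in> sets M" for u :: "(nat \<Rightarrow> 'r) \<times> (nat \<Rightarrow> 's) \<Rightarrow> real" and S
    using that by (subst Bochner_Integration.integral_sum) (auto simp: emeasure_eq_measure)
  have h': "prefix_determined k (\<lambda>a b. h a b * (P $ a k $ \<alpha> * Q $ b k $ \<beta>))"
    using h unfolding prefix_determined_def by (metis order_refl)
  have "h (\<lambda>i. X i \<omega>) (\<lambda>i. Y i \<omega>) * of_bool (X (Suc k) \<omega> = \<alpha> \<and> Y (Suc k) \<omega> = \<beta>) =
      (\<Sum>p\<in>prefix_pairs k. h (fst p) (snd p) * indicator (J p) \<omega>)" if "\<omega> \<in> space M" for \<omega>
  proof -
    have "indicator (J p) \<omega> = (indicator (I p) \<omega> * of_bool (X (Suc k) \<omega> = \<alpha> \<and> Y (Suc k) \<omega> = \<beta>) :: real)" for p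
      by (auto simp: I_def J_def prefix_event_def le_Suc_eq indicator_def)
    then show ?thesis
      unfolding prefix_expansion[OF h that, of X Y] I_def[symmetric]
      by (simp add: sum_distrib_right mult.assoc)
  qed
  then have "expectation (\<lambda>\<omega>. h (\<lambda>i. X i \<omega>) (\<lambda>i. Y i \<omega>) * of_bool (X (Suc k) \<omega> = \<alpha> \<and> Y (Suc k) \<omega> = \<beta>)) =
      (\<Sum>p\<in>prefix_pairs k. h (fst p) (snd p) * prob (J p))"
    by (subst expect_sum[OF sets(2), symmetric]) (auto intro!: Bochner_Integration.integral_cong)
  also have "\<dots> = (\<Sum>p\<in>prefix_pairs k. h (fst p) (snd p) * (P $ fst p k $ \<alpha> * Q $ snd p k $ \<beta>) * prob (I p))"
    by (intro sum.cong) (simp_all add: prob_J)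
  also have "\<dots> = expectation (\<lambda>\<omega>. h (\<lambda>i. X i \<omega>) (\<lambda>i. Y i \<omega>) * (P $ X k \<omega> $ \<alpha> * Q $ Y k \<omega> $ \<beta>))"
    by (subst expect_sum[OF sets(1), symmetric], intro Bochner_Integration.integral_cong)
      (simp_all add: prefix_expansion[OF h', of _ _ X Y] I_def)
  finally show ?thesis .
qed

section \<open>Quadratic forms\<close>

text \<open>The ratio of the two forms attains its maximum on the compact unit sphere, and
  homogeneity extends the bound to all vectors. The maximizer is returned, because the users need
  the sign of the ratio or its comparison with 1.\<close>

lemma quadratic_sphere_bound:
  fixes p q :: "real^'n \<Rightarrow> real"
  assumes "continuous_on UNIV p" "continuous_on UNIV q"
    and p2: "\<And>t u. p (t *\<^sub>R u) = t\<^sup>2 * p u" and q2: "\<And>t u. q (t *\<^sub>R u) = t\<^sup>2 * q u"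
    and q: "\<And>u. u \<noteq> 0 \<Longrightarrow> q u > 0"
  obtains u0 where "u0 \<noteq> 0" "\<And>u. p u \<le> p u0 / q u0 * q u"
proof -
  have ne: "q u \<noteq> 0" if "u \<in> sphere 0 1" for u using q[of u] that by (cases "u = 0") auto
  have "continuous_on (sphere 0 1) (\<lambda>u. p u / q u)"
    using assms(1,2) ne by (intro continuous_on_divide) (auto intro: continuous_on_subset)
  moreover have "axis undefined 1 \<in> (sphere 0 1 :: (real^'n) set)" by (simp add: norm_axis_1)
  then have "sphere 0 1 \<noteq> ({} :: (real^'n) set)" by blast
  ultimately have "\<exists>u0\<in>sphere 0 1. \<forall>u\<in>sphere 0 1. p u / q u \<le> p u0 / q u0"
    by (intro continuous_attains_sup compact_sphere)
  then obtain u0 :: "real^'n" where u0: "u0 \<in> sphere 0 1"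
    and max: "\<And>u. u \<in> sphere 0 1 \<Longrightarrow> p u / q u \<le> p u0 / q u0"
    by blast
  show ?thesis
  proof
    show "u0 \<noteq> 0" using u0 by auto
    fix u
    show "p u \<le> p u0 / q u0 * q u"
    proof (cases "u = 0")
      case True
      then show ?thesis using p2[of 0 0] q2[of 0 0] by simp
    next
      case False
      let ?v = "(1 / norm u) *\<^sub>R u"
      have v: "?v \<in> sphere 0 1" using False by simp
      have u: "u = norm u *\<^sub>R ?v" using False by simp
      have "q ?v > 0" using False by (intro q) simp
      then have "p ?v \<le> p u0 / q u0 * q ?v" using max[OF v] by (simp add: pos_divide_le_eq)
      then have "(norm u)\<^sup>2 * p ?v \<le> p u0 / q u0 * ((norm u)\<^sup>2 * q ?v)"
        by (metis mult.left_commute mult_left_mono zero_le_power2)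
      then show ?thesis by (metis u p2 q2)
    qed
  qed
qed

lemma quadratic_contraction:
  fixes p q :: "real^'n \<Rightarrow> real"
  assumes "continuous_on UNIV p" "continuous_on UNIV q"
    and "\<And>t u. p (t *\<^sub>R u) = t\<^sup>2 * p u" "\<And>t u. q (t *\<^sub>R u) = t\<^sup>2 * q u"
    and q: "\<And>u. u \<noteq> 0 \<Longrightarrow> q u > 0" and pq: "\<And>u. u \<noteq> 0 \<Longrightarrow> p u < q u"
  shows "\<exists>\<kappa>\<in>{0..<1}. \<forall>u. p u \<le> \<kappa> * q u"
proof -
  obtain u0 where u0: "u0 \<noteq> 0" "\<And>u. p u \<le> p u0 / q u0 * q u"
    using quadratic_sphere_bound[OF assms(1-5)] by blast
  have q0: "q u \<ge> 0" for u
    using q[of u] assms(4)[of 0 u] by (cases "u = 0") auto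
  \<comment> \<open>The ratio may be negative, whereas a contraction factor has to be
    nonnegative.\<close>
  have "p u \<le> max 0 (p u0 / q u0) * q u" for u
    using u0(2)[of u] mult_right_mono[OF _ q0[of u], of "p u0 / q u0" "max 0 (p u0 / q u0)"] by linarith
  moreover have "max 0 (p u0 / q u0) \<in> {0..<1}" using q[OF u0(1)] pq[OF u0(1)] by auto
  ultimately show ?thesis by blast
qed

lemma quadratic_coercive:
  fixes q :: "real^'n \<Rightarrow> real"
  assumes "continuous_on UNIV q" "\<And>t u. q (t *\<^sub>R u) = t\<^sup>2 * q u" "\<And>u. u \<noteq> 0 \<Longrightarrow> q u > 0"
  shows "\<exists>C>0. \<forall>u. (norm u)\<^sup>2 \<le> C * q u"
proof -
  obtain u0 :: "real^'n" where u0: "u0 \<noteq> 0" "\<And>u. (norm u)\<^sup>2 \<le> (norm u0)\<^sup>2 / q u0 * q u"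
  proof (rule quadratic_sphere_bound[of "\<lambda>u. (norm u)\<^sup>2" q])
    show "continuous_on UNIV (\<lambda>u::real^'n. (norm u)\<^sup>2)" by (intro continuous_intros)
  qed (use assms in \<open>auto simp: power_mult_distrib\<close>)
  then have "(norm u0)\<^sup>2 / q u0 > 0" using assms(3)[of u0] by simp
  then show ?thesis using u0(2) by blast
qed

lemma quadratic_form_scaleR: "(t *\<^sub>R u) \<bullet> (M *v (t *\<^sub>R u)) = t\<^sup>2 * (u \<bullet> (M *v (u::real^'n)))"
  by (simp add: matrix_vector_mult_scaleR power2_eq_square)

text \<open>The factor \<open>L\<close> covers forms evaluated along the transposed closed-loop map;
  the identity matrix recovers the plain form.\<close>

lemma continuous_on_quadratic_form: "continuous_on S (\<lambda>u::real^'n. (L *v u) \<bullet> (M *v (L *v u)))"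
  by (intro continuous_on_inner matrix_vector_mult_linear_continuous_on
        continuous_on_compose2[OF matrix_vector_mult_linear_continuous_on[of UNIV M]]) auto

section \<open>Quadratic forms of block matrices\<close>

lemma sum_UNIV_Plus:
  "(\<Sum>i\<in>(UNIV :: ('a::finite + 'b::finite) set). g i) = (\<Sum>a\<in>UNIV. g (Inl a)) + (\<Sum>b\<in>UNIV. g (Inr b))"
  unfolding UNIV_Plus_UNIV[symmetric] by (subst sum.Plus) auto

lemma sym_block_quadratic_form:
  fixes A :: "real^'a^'a" and B :: "real^'b^'a" and D :: "real^'b^'b"
  defines "pair \<equiv> \<lambda>(x :: real^'a) (y :: real^'b). (\<chi> i. case i of Inl a \<Rightarrow> x $ a | Inr b \<Rightarrow> y $ b) :: real^('a + 'b)"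
  shows "pair x y \<bullet> (sym_block A B D *v pair x y) = x \<bullet> (A *v x) + 2 * (x \<bullet> (B *v y)) + y \<bullet> (D *v y)"
proof -
  have inner_pair: "pair x y \<bullet> pair x' y' = x \<bullet> x' + y \<bullet> y'" for x x' y y'
    by (simp add: pair_def inner_vec_def sum_UNIV_Plus)
  have "sym_block A B D *v pair x y = pair (A *v x + B *v y) (transpose B *v x + D *v y)"
    by (simp add: vec_eq_iff matrix_vector_mult_def sym_block_def block_matrix_def pair_def
        sum_UNIV_Plus split: sum.split)
  moreover have "y \<bullet> (transpose B *v x) = x \<bullet> (B *v y)"
    by (metis dot_lmul_matrix inner_commute matrix_transpose_mul transpose_matrix_vector transpose_transpose)
  ultimately show ?thesis by (simp add: inner_pair inner_add_right)
qed

lemma pos_def_sym_block: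
  fixes x :: "real^'a" and y :: "real^'b"
  assumes "pos_def (sym_block A B D)" "x \<noteq> 0 \<or> y \<noteq> 0"
  shows "x \<bullet> (A *v x) + 2 * (x \<bullet> (B *v y)) + y \<bullet> (D *v y) > 0"
proof -
  have "(\<chi> i. case i of Inl a \<Rightarrow> x $ a | Inr b \<Rightarrow> y $ b) \<noteq> (0 :: real^('a + 'b))"
    using assms(2) unfolding vec_eq_iff by (metis (mono_tags, lifting) sum.simps(5,6) vec_lambda_beta zero_index)
  then show ?thesis using assms(1) unfolding pos_def_def
    by (auto simp flip: sym_block_quadratic_form)
qed

lemma transpose_quadratic_form: "x \<bullet> (transpose M *v x) = x \<bullet> (M *v (x::real^'n))"
  by (metis dot_lmul_matrix inner_commute transpose_matrix_vector)

text \<open>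
  Testing the block matrix on (x, -v), with v the image of x under the transposed closed-loop
  matrix, cancels the terms in \<open>G\<close>; this replaces the usual Schur complement.
\<close>

lemma pos_def_sym_block_gain:
  fixes S :: "real^'a^'a" and A :: "real^'n^'a" and G D :: "real^'n^'n"
  assumes pd: "pos_def (sym_block S (A ** G + B ** F) (G + transpose G - D))"
    and D: "\<And>u. u \<bullet> (D *v u) \<ge> 0" and K: "K = F ** matrix_inv G" and x: "x \<noteq> 0"
  shows "(transpose (A + B ** K) *v x) \<bullet> (D *v (transpose (A + B ** K) *v x)) < x \<bullet> (S *v x)"
proof -
  \<comment> \<open>On the kernel of \<open>G\<close> the lower right block reduces to the form of
    \<open>-D\<close>, which is never positive. So \<open>G\<close> is injective and its inverse is
    genuine.\<close>
  have "y = 0" if "G *v y = 0" for y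
  proof (rule ccontr)
    assume "y \<noteq> 0"
    then have "y \<bullet> ((G + transpose G - D) *v y) > 0" using pos_def_sym_block[OF pd, of 0 y] by simp
    then have "y \<bullet> (D *v y) < 0"
      by (simp add: that matrix_vector_mult_add_rdistrib matrix_vector_mult_diff_rdistrib inner_diff_right
          inner_add_right transpose_quadratic_form del: transpose_matrix_vector)
    then show False using D[of y] by simp
  qed
  then have "invertible G"
    by (metis invertible_left_inverse matrix_left_invertible_ker)
  then have "matrix_inv G ** G = mat 1"
    unfolding matrix_inv_def invertible_def by (rule someI2_ex) simp
  then have "B ** F = B ** K ** G"
    by (simp add: K flip: matrix_mul_assoc)
  then have AG: "(A ** G + B ** F) *v y = (A + B ** K) *v (G *v y)" for y
    by (simp add: matrix_vector_mult_add_rdistrib flip: matrix_vector_mul_assoc)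
  define v where "v = transpose (A + B ** K) *v x"
  have xv: "x \<bullet> ((A + B ** K) *v y) = v \<bullet> y" for y
    by (simp add: v_def transpose_matrix_vector dot_lmul_matrix)
  have "x \<bullet> (S *v x) + 2 * (x \<bullet> ((A ** G + B ** F) *v (- v))) + (- v) \<bullet> ((G + transpose G - D) *v (- v)) > 0"
    using x by (intro pos_def_sym_block[OF pd]) simp
  then have "x \<bullet> (S *v x) - v \<bullet> (D *v v) > 0"
    unfolding AG xv
    by (simp add: matrix_vector_mult_add_rdistrib matrix_vector_mult_diff_rdistrib inner_diff_right
          inner_add_right transpose_quadratic_form vec.neg del: transpose_matrix_vector)
  then show ?thesis by (simp add: v_def)
qed

section \<open>Second moments of the closed loop\<close>

text \<open>
  The state at time k + 1 is paired with the mode at time k, the mode that produced it. In this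
  pairing the second moments evolve by the operator that occurs in the matrix inequalities.
\<close>

definition second_moment ::
    "'w measure \<Rightarrow> (nat \<Rightarrow> 'w \<Rightarrow> 'c) \<Rightarrow> (nat \<Rightarrow> 'w \<Rightarrow> real^'n) \<Rightarrow> 'c \<Rightarrow> nat \<Rightarrow> real^'n \<Rightarrow> real" where
  "second_moment \<Omega> \<xi> x c k u = (LINT \<omega>|\<Omega>. (u \<bullet> x (Suc k) \<omega>)\<^sup>2 * of_bool (\<xi> k \<omega> = c))"

text \<open>The row dimension is left free, so that both the state matrix A + BK and the output
  matrix C + DK are instances.\<close>

fun closed_mat ::
    "('r \<Rightarrow> real^'n^'a) \<Rightarrow> ('r \<Rightarrow> real^'m^'a) \<Rightarrow> ('r \<Rightarrow> nat \<Rightarrow> real^'n^'m) \<Rightarrow> ('r, 's) ext_mode \<Rightarrow> real^'n^'a"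
where
  "closed_mat A B K (\<alpha>, \<beta>, \<gamma>, \<delta>) = A \<alpha> + B \<alpha> ** K \<gamma> \<delta>"

lemma finite_ext_modes: "finite (ext_modes f T :: ('r::finite, 's::finite) ext_mode set)"
  by (rule finite_subset[of _ "UNIV \<times> UNIV \<times> UNIV \<times> {1..T}"]) (auto simp: ext_modes_def)

lemma norm_sq_eq_sum_axis: "(norm x)\<^sup>2 = (\<Sum>j\<in>UNIV. (axis j 1 \<bullet> (x::real^'n))\<^sup>2)"
  unfolding power2_norm_eq_inner inner_axis' by (simp add: inner_vec_def power2_eq_square)

lemma inner_transpose_mult: "u \<bullet> (M *v x) = (transpose M *v u) \<bullet> (x::real^'n)"
  by (simp add: transpose_matrix_vector dot_lmul_matrix)

lemma cl_state_eq:
  "cl_state A B E K f T r s \<tau>0 x0 c w k \<omega> =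
     loop_state A B E K (\<lambda>j. r j \<omega>)
       (obs_mode f (\<tau>0 c) (fst (snd (snd c))) (\<lambda>j. r j \<omega>) (\<lambda>j. s j \<omega>))
       (obs_age f T (\<tau>0 c) (\<lambda>j. s j \<omega>)) x0 w k"
  by (cases c) simp

lemma cl_output_eq:
  "cl_output A B C D E K f T r s \<tau>0 x0 c w k \<omega> =
     closed_mat C D K (r k \<omega>, s k \<omega>,
       obs_mode f (\<tau>0 c) (fst (snd (snd c))) (\<lambda>j. r j \<omega>) (\<lambda>j. s j \<omega>) k,
       obs_age f T (\<tau>0 c) (\<lambda>j. s j \<omega>) k) *v cl_state A B E K f T r s \<tau>0 x0 c w k \<omega>"
  by (cases c) simp

text \<open>One initial mode with its realization. A disturbance vanishing after time 0 covers both
  uses: none at all for stability, an impulse for the \<open>H\<^sub>2\<close> norm.\<close>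

locale realized_loop =
  fixes f :: "'s::finite \<Rightarrow> bool" and T :: nat
    and P :: "real^'r^'r" and Q :: "real^'s^'s"
    and \<Omega> :: "'w measure" and r :: "nat \<Rightarrow> 'w \<Rightarrow> 'r::finite" and s :: "nat \<Rightarrow> 'w \<Rightarrow> 's"
    and \<tau>0 :: "('r, 's) ext_mode \<Rightarrow> int" and c :: "('r, 's) ext_mode"
    and A :: "'r \<Rightarrow> real^'n^'n" and B :: "'r \<Rightarrow> real^'m^'n" and E :: "'r \<Rightarrow> real^'q^'n"
    and K :: "'r \<Rightarrow> nat \<Rightarrow> real^'n^'m" and x0 :: "real^'n" and w :: "nat \<Rightarrow> real^'q"
  assumes T: "T > 0" and c: "c \<in> ext_modes f T"
    and realization: "realization f T P Q \<Omega> r s (\<tau>0 c) c"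
    and w: "\<And>k. k > 0 \<Longrightarrow> w k = 0"
begin

sublocale prob_space \<Omega>
  using realization by (cases c) simp

lemma chain_r: "markov_chain \<Omega> r P" and chain_s: "markov_chain \<Omega> s Q"
  and indep: "indep_processes \<Omega> r s"
  using realization by (cases c, simp)+

primrec path_state :: "(nat \<Rightarrow> 'r) \<Rightarrow> (nat \<Rightarrow> 's) \<Rightarrow> nat \<Rightarrow> real^'n" where
  "path_state a b 0 = x0"
| "path_state a b (Suc k) =
     closed_mat A B K (ext_path f T c a b k) *v path_state a b k + E (fst (ext_path f T c a b k)) *v w k"

abbreviation mode :: "nat \<Rightarrow> 'w \<Rightarrow> ('r, 's) ext_mode" where
  "mode k \<omega> \<equiv> ext_path f T c (\<lambda>i. r i \<omega>) (\<lambda>i. s i \<omega>) k"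

abbreviation state :: "nat \<Rightarrow> 'w \<Rightarrow> real^'n" where
  "state k \<omega> \<equiv> path_state (\<lambda>i. r i \<omega>) (\<lambda>i. s i \<omega>) k"

text \<open>The state at time \<open>k + 1\<close> is already fixed by the paths up to time
  \<open>k\<close>. This makes it possible to condition on that history while the mode moves
  on.\<close>

lemma path_state_Suc_cong:
  assumes "\<And>i. i \<le> k \<Longrightarrow> a i = a' i" "\<And>i. i \<le> k \<Longrightarrow> b i = b' i"
  shows "path_state a b (Suc k) = path_state a' b' (Suc k)"
  using assms
proof (induction k)
  case (Suc k)
  have "path_state a b (Suc k) = path_state a' b' (Suc k)" using Suc by simp
  moreover have "ext_path f T c a b (Suc k) = ext_path f T c a' b' (Suc k)"
    using Suc.prems by (rule ext_path_cong)
  ultimately show ?case by (simp only: path_state.simps(2)[of a b "Suc k"] path_state.simps(2)[of a' b' "Suc k"])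
qed simp

lemma prefix_determined_loop: "prefix_determined k (\<lambda>a b. h (path_state a b (Suc k)) (ext_path f T c a b k))"
  unfolding prefix_determined_def
proof (intro allI impI)
  fix a a' :: "nat \<Rightarrow> 'r" and b b' :: "nat \<Rightarrow> 's"
  assume "\<forall>i\<le>k. a i = a' i" "\<forall>i\<le>k. b i = b' i"
  then have "path_state a b (Suc k) = path_state a' b' (Suc k)"
    and "ext_path f T c a b k = ext_path f T c a' b' k"
    by (blast intro: path_state_Suc_cong ext_path_cong)+
  then show "h (path_state a b (Suc k)) (ext_path f T c a b k) =
      h (path_state a' b' (Suc k)) (ext_path f T c a' b' k)"
    by (simp only:)
qed

lemma integrable_loop:
  fixes h :: "real^'n \<Rightarrow> ('r, 's) ext_mode \<Rightarrow> real"
  shows "integrable \<Omega> (\<lambda>\<omega>. h (state (Suc k) \<omega>) (mode k \<omega>))"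
  by (rule integrable_prefix_determined[OF chain_r chain_s prefix_determined_loop])

lemma integrable_loop_Suc:
  fixes h :: "real^'n \<Rightarrow> ('r, 's) ext_mode \<Rightarrow> real"
  shows "integrable \<Omega> (\<lambda>\<omega>. h (state (Suc k) \<omega>) (mode (Suc k) \<omega>))"
proof (rule integrable_prefix_determined[OF chain_r chain_s])
  show "prefix_determined (Suc k) (\<lambda>a b. h (path_state a b (Suc k)) (ext_path f T c a b (Suc k)))"
    unfolding prefix_determined_def
  proof (intro allI impI)
    fix a a' :: "nat \<Rightarrow> 'r" and b b' :: "nat \<Rightarrow> 's"
    assume "\<forall>i\<le>Suc k. a i = a' i" "\<forall>i\<le>Suc k. b i = b' i"
    then have "path_state a b (Suc k) = path_state a' b' (Suc k)"
      and "ext_path f T c a b (Suc k) = ext_path f T c a' b' (Suc k)"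
      by (blast intro: path_state_Suc_cong ext_path_cong le_SucI)+
    then show "h (path_state a b (Suc k)) (ext_path f T c a b (Suc k)) =
        h (path_state a' b' (Suc k)) (ext_path f T c a' b' (Suc k))"
      by (simp only:)
  qed
qed

lemma AE_mode:
  "AE \<omega> in \<Omega>. \<forall>k. mode k \<omega> = (r k \<omega>, s k \<omega>,
     obs_mode f (\<tau>0 c) (fst (snd (snd c))) (\<lambda>j. r j \<omega>) (\<lambda>j. s j \<omega>) k,
     obs_age f T (\<tau>0 c) (\<lambda>j. s j \<omega>) k)"
proof (cases c)
  case (fields \<alpha> \<beta> \<gamma> \<delta>)
  have init: "AE \<omega> in \<Omega>. r 0 \<omega> = \<alpha>" "AE \<omega> in \<Omega>. s 0 \<omega> = \<beta>"
    and \<tau>0: "nat ((- \<tau>0 c) mod int T) + 1 = \<delta>"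
    using realization by (simp_all add: fields)
  from init show ?thesis
  proof eventually_elim
    case (elim \<omega>)
    have "mode k \<omega> = (r k \<omega>, s k \<omega>,
      obs_mode f (\<tau>0 c) (fst (snd (snd c))) (\<lambda>j. r j \<omega>) (\<lambda>j. s j \<omega>) k,
      obs_age f T (\<tau>0 c) (\<lambda>j. s j \<omega>) k)" for k
      using ext_path_eq_obs[of T \<alpha> \<beta> \<gamma> \<delta> f "\<lambda>j. r j \<omega>" "\<lambda>j. s j \<omega>" "\<tau>0 c" k] T c elim \<tau>0
      by (simp add: fields)
    then show ?case ..
  qed
qed

lemma AE_cl_state: "AE \<omega> in \<Omega>. \<forall>k. cl_state A B E K f T r s \<tau>0 x0 c w k \<omega> = state k \<omega>"
  using AE_mode
proof eventually_elim
  case (elim \<omega>)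
  have "cl_state A B E K f T r s \<tau>0 x0 c w k \<omega> = state k \<omega>" for k
    unfolding cl_state_eq using elim by (induction k) simp_all
  then show ?case ..
qed

lemma AE_cl_output:
  "AE \<omega> in \<Omega>. \<forall>k. cl_output A B C D E K f T r s \<tau>0 x0 c w k \<omega> =
     closed_mat C D K (mode k \<omega>) *v state k \<omega>"
  using AE_mode AE_cl_state
proof eventually_elim
  case (elim \<omega>)
  then show ?case unfolding cl_output_eq by simp
qed

text \<open>The state stays at time \<open>k + 1\<close> while the mode advances from
  \<open>k\<close> to \<open>k + 1\<close>: the state belongs to the history, so only the transition
  of the mode is averaged.\<close>

lemma expectation_next_mode:
  assumes c': "c' \<in> ext_modes f T"
  shows "expectation (\<lambda>\<omega>. (v \<bullet> state (Suc k) \<omega>)\<^sup>2 * of_bool (mode (Suc k) \<omega> = c')) =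
    (\<Sum>d\<in>ext_modes f T. ext_trans f T P Q d c' * second_moment \<Omega> mode state d k v)"
proof -
  obtain \<alpha> \<beta> \<gamma> \<delta> where cc: "c' = (\<alpha>, \<beta>, \<gamma>, \<delta>)" by (cases c')
  define h where "h = (\<lambda>x d. (v \<bullet> x)\<^sup>2 * of_bool (ext_step f T d \<alpha> \<beta> = c') :: real)"
  have fst_step: "fst (ext_step f T d a b) = a \<and> fst (snd (ext_step f T d a b)) = b" for d a b
    by (cases d) auto
  \<comment> \<open>Reaching \<open>c'\<close> forces the new values of both chains. What remains is
    a condition on the old mode, which \<open>h\<close> absorbs.\<close>
  have "mode (Suc k) \<omega> = c' \<longleftrightarrow>
      ext_step f T (mode k \<omega>) \<alpha> \<beta> = c' \<and> r (Suc k) \<omega> = \<alpha> \<and> s (Suc k) \<omega> = \<beta>" for \<omega>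
    using fst_step[of "mode k \<omega>" "r (Suc k) \<omega>" "s (Suc k) \<omega>"] by (auto simp: cc)
  then have "expectation (\<lambda>\<omega>. (v \<bullet> state (Suc k) \<omega>)\<^sup>2 * of_bool (mode (Suc k) \<omega> = c')) =
    expectation (\<lambda>\<omega>. h (state (Suc k) \<omega>) (mode k \<omega>) * of_bool (r (Suc k) \<omega> = \<alpha> \<and> s (Suc k) \<omega> = \<beta>))"
    unfolding h_def by (simp only: of_bool_conj mult.assoc)
  also have "\<dots> = expectation (\<lambda>\<omega>. h (state (Suc k) \<omega>) (mode k \<omega>) * (P $ r k \<omega> $ \<alpha> * Q $ s k \<omega> $ \<beta>))"
    by (rule expectation_markov_step[OF chain_r chain_s indep prefix_determined_loop])
  also have "\<dots> = expectation (\<lambda>\<omega>. \<Sum>d\<in>ext_modes f T.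
      ext_trans f T P Q d c' * ((v \<bullet> state (Suc k) \<omega>)\<^sup>2 * of_bool (mode k \<omega> = d)))"
  \<comment> \<open>The integrands agree only almost everywhere, because the first two components of
    the mode equal the chains only where the initial values are the prescribed ones.\<close>
  proof (rule integral_cong_AE)
    show "(\<lambda>\<omega>. h (state (Suc k) \<omega>) (mode k \<omega>) * (P $ r k \<omega> $ \<alpha> * Q $ s k \<omega> $ \<beta>)) \<in> borel_measurable \<Omega>"
    proof (rule borel_measurable_integrable, rule integrable_prefix_determined[OF chain_r chain_s])
      show "prefix_determined k (\<lambda>a b. h (path_state a b (Suc k)) (ext_path f T c a b k) *
          (P $ a k $ \<alpha> * Q $ b k $ \<beta>))"
        using prefix_determined_loop[of k h] unfolding prefix_determined_def
        by (intro allI impI arg_cong2[where f = "(*)"]) (blast, simp, simp)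
    qed
    show "(\<lambda>\<omega>. \<Sum>d\<in>ext_modes f T.
      ext_trans f T P Q d c' * ((v \<bullet> state (Suc k) \<omega>)\<^sup>2 * of_bool (mode k \<omega> = d))) \<in> borel_measurable \<Omega>"
      by (rule borel_measurable_integrable, rule integrable_loop)
    show "AE \<omega> in \<Omega>. h (state (Suc k) \<omega>) (mode k \<omega>) * (P $ r k \<omega> $ \<alpha> * Q $ s k \<omega> $ \<beta>) =
      (\<Sum>d\<in>ext_modes f T. ext_trans f T P Q d c' * ((v \<bullet> state (Suc k) \<omega>)\<^sup>2 * of_bool (mode k \<omega> = d)))"
      using AE_mode
    proof eventually_elim
      case (elim \<omega>)
      have "(\<Sum>d\<in>ext_modes f T. ext_trans f T P Q d c' * ((v \<bullet> state (Suc k) \<omega>)\<^sup>2 * of_bool (mode k \<omega> = d))) =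
        (\<Sum>d\<in>ext_modes f T. if mode k \<omega> = d then ext_trans f T P Q d c' * (v \<bullet> state (Suc k) \<omega>)\<^sup>2 else 0)"
        by (intro sum.cong) auto
      also have "\<dots> = ext_trans f T P Q (mode k \<omega>) c' * (v \<bullet> state (Suc k) \<omega>)\<^sup>2"
        using ext_path_in[OF T c] by (simp add: finite_ext_modes del: path_state.simps)
      also have "\<dots> = h (state (Suc k) \<omega>) (mode k \<omega>) * (P $ fst (mode k \<omega>) $ \<alpha> * Q $ fst (snd (mode k \<omega>)) $ \<beta>)"
        using ext_trans_eq[OF T c'[unfolded cc], of P Q "mode k \<omega>"] unfolding h_def cc by simp
      finally show ?case using elim by simp
    qed
  qed
  also have "\<dots> = (\<Sum>d\<in>ext_modes f T. ext_trans f T P Q d c' * second_moment \<Omega> mode state d k v)"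
    unfolding second_moment_def
    by (subst Bochner_Integration.integral_sum) (rule integrable_loop, simp)
  finally show ?thesis .
qed

lemma second_moment_0:
  "second_moment \<Omega> mode state d 0 u =
     (u \<bullet> (closed_mat A B K c *v x0 + E (fst c) *v w 0))\<^sup>2 * of_bool (c = d)"
  by (simp add: second_moment_def prob_space)

text \<open>The closed-loop matrix moves to the other side of the inner product as its transpose.
  The disturbance does not enter, since it acts at a positive time.\<close>

lemma second_moment_Suc:
  assumes "d \<in> ext_modes f T"
  shows "second_moment \<Omega> mode state d (Suc k) u =
    (\<Sum>d'\<in>ext_modes f T. ext_trans f T P Q d' d *
       second_moment \<Omega> mode state d' k (transpose (closed_mat A B K d) *v u))"
proof -
  have "(u \<bullet> state (Suc (Suc k)) \<omega>)\<^sup>2 * of_bool (mode (Suc k) \<omega> = d) =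
      ((transpose (closed_mat A B K d) *v u) \<bullet> state (Suc k) \<omega>)\<^sup>2 * of_bool (mode (Suc k) \<omega> = d)" for \<omega>
    by (cases "mode (Suc k) \<omega> = d")
      (simp_all only: path_state.simps(2)[of _ _ "Suc k"] w[OF zero_less_Suc] inner_transpose_mult
        matrix_vector_mult_0_right add_0_right of_bool_eq mult_zero_right)
  then show ?thesis
    unfolding expectation_next_mode[OF assms, symmetric] by (simp only: second_moment_def)
qed

lemma mean_square_cl_state_0: "mean_square \<Omega> (cl_state A B E K f T r s \<tau>0 x0 c w 0) = ennreal ((norm x0)\<^sup>2)"
  by (cases c) (simp add: mean_square_def emeasure_space_1)

lemma mean_square_cl_state_Suc:
  "mean_square \<Omega> (cl_state A B E K f T r s \<tau>0 x0 c w (Suc k)) =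
     ennreal (\<Sum>d\<in>ext_modes f T. \<Sum>j\<in>UNIV. second_moment \<Omega> mode state d k (axis j 1))"
proof -
  have "mean_square \<Omega> (cl_state A B E K f T r s \<tau>0 x0 c w (Suc k)) =
      (\<integral>\<^sup>+ \<omega>. ennreal ((norm (state (Suc k) \<omega>))\<^sup>2) \<partial>\<Omega>)"
    unfolding mean_square_def by (rule nn_integral_cong_AE) (use AE_cl_state in \<open>eventually_elim, simp only:\<close>)
  also have "\<dots> = ennreal (expectation (\<lambda>\<omega>. (norm (state (Suc k) \<omega>))\<^sup>2))"
    by (intro nn_integral_eq_integral integrable_loop) simp
  also have "(\<lambda>\<omega>. (norm (state (Suc k) \<omega>))\<^sup>2) =
      (\<lambda>\<omega>. \<Sum>d\<in>ext_modes f T. \<Sum>j\<in>UNIV. (axis j 1 \<bullet> state (Suc k) \<omega>)\<^sup>2 * of_bool (mode k \<omega> = d))"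
  proof
    fix \<omega>
    have "(\<Sum>d\<in>ext_modes f T. \<Sum>j\<in>UNIV. (axis j 1 \<bullet> state (Suc k) \<omega>)\<^sup>2 * of_bool (mode k \<omega> = d)) =
      (\<Sum>d\<in>ext_modes f T. if mode k \<omega> = d then (norm (state (Suc k) \<omega>))\<^sup>2 else 0)"
      unfolding norm_sq_eq_sum_axis by (intro sum.cong) auto
    then show "(norm (state (Suc k) \<omega>))\<^sup>2 =
      (\<Sum>d\<in>ext_modes f T. \<Sum>j\<in>UNIV. (axis j 1 \<bullet> state (Suc k) \<omega>)\<^sup>2 * of_bool (mode k \<omega> = d))"
      using ext_path_in[OF T c] by (simp add: finite_ext_modes del: path_state.simps)
  qed
  also have "expectation \<dots> = (\<Sum>d\<in>ext_modes f T. \<Sum>j\<in>UNIV. second_moment \<Omega> mode state d k (axis j 1))"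
    unfolding second_moment_def
    by (subst Bochner_Integration.integral_sum, rule integrable_loop,
        subst Bochner_Integration.integral_sum, rule integrable_loop, rule refl)
  finally show ?thesis .
qed

text \<open>The output pairs state and mode of the same time, hence the additional transition
  compared with \<open>second_moment\<close>. Nonnegativity is recorded because
  \<open>ennreal\<close> truncates negative numbers, and the real values are summed later.\<close>

lemma mean_square_cl_output_Suc:
  fixes C :: "'r \<Rightarrow> real^'n^'l" and D :: "'r \<Rightarrow> real^'m^'l"
  shows "mean_square \<Omega> (cl_output A B C D E K f T r s \<tau>0 x0 c w (Suc k)) =
       ennreal (\<Sum>d\<in>ext_modes f T. \<Sum>j\<in>UNIV. \<Sum>d'\<in>ext_modes f T. ext_trans f T P Q d' d *
         second_moment \<Omega> mode state d' k (transpose (closed_mat C D K d) *v axis j 1))"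
    and "(\<Sum>d\<in>ext_modes f T. \<Sum>j\<in>UNIV. \<Sum>d'\<in>ext_modes f T. ext_trans f T P Q d' d *
         second_moment \<Omega> mode state d' k (transpose (closed_mat C D K d) *v axis j 1)) \<ge> 0"
proof -
  let ?z = "\<lambda>\<omega>. closed_mat C D K (mode (Suc k) \<omega>) *v state (Suc k) \<omega>"
  have "mean_square \<Omega> (cl_output A B C D E K f T r s \<tau>0 x0 c w (Suc k)) =
      (\<integral>\<^sup>+ \<omega>. ennreal ((norm (?z \<omega>))\<^sup>2) \<partial>\<Omega>)"
    unfolding mean_square_def by (rule nn_integral_cong_AE) (use AE_cl_output[of C D] in \<open>eventually_elim, simp only:\<close>)
  also have "\<dots> = ennreal (expectation (\<lambda>\<omega>. (norm (?z \<omega>))\<^sup>2))"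
    by (intro nn_integral_eq_integral integrable_loop_Suc) simp
  finally have ms: "mean_square \<Omega> (cl_output A B C D E K f T r s \<tau>0 x0 c w (Suc k)) =
      ennreal (expectation (\<lambda>\<omega>. (norm (?z \<omega>))\<^sup>2))" .
  have nonneg: "expectation (\<lambda>\<omega>. (norm (?z \<omega>))\<^sup>2) \<ge> 0" by simp
  have "(norm (?z \<omega>))\<^sup>2 = (\<Sum>d\<in>ext_modes f T. \<Sum>j\<in>UNIV.
      ((transpose (closed_mat C D K d) *v axis j 1) \<bullet> state (Suc k) \<omega>)\<^sup>2 * of_bool (mode (Suc k) \<omega> = d))" for \<omega>
  proof -
    have "(\<Sum>d\<in>ext_modes f T. \<Sum>j\<in>UNIV.
        ((transpose (closed_mat C D K d) *v axis j 1) \<bullet> state (Suc k) \<omega>)\<^sup>2 * of_bool (mode (Suc k) \<omega> = d)) =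
      (\<Sum>d\<in>ext_modes f T. if mode (Suc k) \<omega> = d then
        (norm (closed_mat C D K d *v state (Suc k) \<omega>))\<^sup>2 else 0)"
      unfolding norm_sq_eq_sum_axis[of "closed_mat C D K _ *v _"] inner_transpose_mult by (intro sum.cong) auto
    then show ?thesis using ext_path_in[OF T c]
      by (simp add: finite_ext_modes del: ext_path.simps path_state.simps)
  qed
  then have "expectation (\<lambda>\<omega>. (norm (?z \<omega>))\<^sup>2) =
    expectation (\<lambda>\<omega>. \<Sum>d\<in>ext_modes f T. \<Sum>j\<in>UNIV.
      ((transpose (closed_mat C D K d) *v axis j 1) \<bullet> state (Suc k) \<omega>)\<^sup>2 * of_bool (mode (Suc k) \<omega> = d))"
    by (simp only:)
  also have "\<dots> = (\<Sum>d\<in>ext_modes f T. \<Sum>j\<in>UNIV. expectation (\<lambda>\<omega>.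
      ((transpose (closed_mat C D K d) *v axis j 1) \<bullet> state (Suc k) \<omega>)\<^sup>2 * of_bool (mode (Suc k) \<omega> = d)))"
    by (subst Bochner_Integration.integral_sum, rule integrable_loop_Suc,
        subst Bochner_Integration.integral_sum, rule integrable_loop_Suc, rule refl)
  also have "\<dots> = (\<Sum>d\<in>ext_modes f T. \<Sum>j\<in>UNIV. \<Sum>d'\<in>ext_modes f T. ext_trans f T P Q d' d *
       second_moment \<Omega> mode state d' k (transpose (closed_mat C D K d) *v axis j 1))"
    by (intro sum.cong refl expectation_next_mode)
  finally show "mean_square \<Omega> (cl_output A B C D E K f T r s \<tau>0 x0 c w (Suc k)) =
       ennreal (\<Sum>d\<in>ext_modes f T. \<Sum>j\<in>UNIV. \<Sum>d'\<in>ext_modes f T. ext_trans f T P Q d' d *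
         second_moment \<Omega> mode state d' k (transpose (closed_mat C D K d) *v axis j 1))"
    and "(\<Sum>d\<in>ext_modes f T. \<Sum>j\<in>UNIV. \<Sum>d'\<in>ext_modes f T. ext_trans f T P Q d' d *
         second_moment \<Omega> mode state d' k (transpose (closed_mat C D K d) *v axis j 1)) \<ge> 0"
    using ms nonneg by simp_all
qed

end

section \<open>Comparison with the solution of the matrix inequalities\<close>

lemma ext_D_quadratic_form:
  "u \<bullet> (ext_D f T P Q R c *v u) = (\<Sum>d\<in>ext_modes f T. ext_trans f T P Q d c * (u \<bullet> (R d *v u)))"
proof -
  have "(\<Sum>d\<in>X. g d *\<^sub>R R d) *v u = (\<Sum>d\<in>X. g d *\<^sub>R (R d *v u))" for X g
    by (induction X rule: infinite_finite_induct)
      (simp_all add: matrix_vector_mult_add_rdistrib scaleR_matrix_vector_assoc)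
  then show ?thesis by (simp add: ext_D_def inner_sum_right)
qed

lemma ext_trans_nonneg:
  assumes "stochastic P" "stochastic Q"
  shows "ext_trans f T P Q d c \<ge> 0"
  using assms by (cases d; cases c) (simp add: stochastic_def)

lemma ennreal_sqrt_power2: "(ennreal_sqrt x)\<^sup>2 = x"
  by (cases x) (simp_all add: ennreal_sqrt_def ennreal_power)

lemma trace_eq_quadratic_form_sum: "trace M = (\<Sum>j\<in>UNIV. axis j 1 \<bullet> (M *v axis j (1::real)))"
  by (simp add: trace_def inner_axis' matrix_vector_mult_basis column_def)

text \<open>A comparison principle: nonnegative weights make the recursion monotone, so a function
  contracted by it dominates all iterates once it dominates the first. Both \<open>d\<close> and
  \<open>u\<close> vary in the induction because the recursion changes them.\<close>

lemma transfer_decay: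
  fixes S :: "'c \<Rightarrow> nat \<Rightarrow> 'v \<Rightarrow> real"
  assumes p: "\<And>d d'. p d' d \<ge> 0" and "b \<ge> 0" "\<kappa> \<ge> 0"
    and base: "\<And>d u. d \<in> X \<Longrightarrow> S d 0 u \<le> b * V d u"
    and step: "\<And>d k u. d \<in> X \<Longrightarrow> S d (Suc k) u = (\<Sum>d'\<in>X. p d' d * S d' k (H d u))"
    and V: "\<And>d u. d \<in> X \<Longrightarrow> (\<Sum>d'\<in>X. p d' d * V d' (H d u)) \<le> \<kappa> * V d u"
    and "d \<in> X"
  shows "S d k u \<le> b * \<kappa> ^ k * V d u"
  using \<open>d \<in> X\<close>
proof (induction k arbitrary: d u)
  case 0
  then show ?case using base by simp
next
  case (Suc k)
  have "S d (Suc k) u \<le> (\<Sum>d'\<in>X. p d' d * (b * \<kappa> ^ k * V d' (H d u)))"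
    unfolding step[OF Suc.prems] by (intro sum_mono mult_left_mono Suc.IH p)
  also have "\<dots> = b * \<kappa> ^ k * (\<Sum>d'\<in>X. p d' d * V d' (H d u))"
    by (simp add: sum_distrib_left mult_ac)
  also have "\<dots> \<le> b * \<kappa> ^ k * (\<kappa> * V d u)"
    using assms(2,3) by (intro mult_left_mono V Suc.prems) simp
  finally show ?case by (simp add: mult_ac)
qed

text \<open>Splitting off the first term exhibits the remaining sum as the image of a shorter one. A
  supersolution of the equation with forcing \<open>S d 0 u\<close> therefore bounds every partial
  sum.\<close>

lemma transfer_partial_sums_le:
  fixes S :: "'c \<Rightarrow> nat \<Rightarrow> 'v \<Rightarrow> real"
  assumes p: "\<And>d d'. p d' d \<ge> 0" and V0: "\<And>d u. d \<in> X \<Longrightarrow> V d u \<ge> 0"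
    and base: "\<And>d u. d \<in> X \<Longrightarrow> S d 0 u + (\<Sum>d'\<in>X. p d' d * V d' (H d u)) \<le> V d u"
    and step: "\<And>d k u. d \<in> X \<Longrightarrow> S d (Suc k) u = (\<Sum>d'\<in>X. p d' d * S d' k (H d u))"
    and "d \<in> X"
  shows "(\<Sum>k<n. S d k u) \<le> V d u"
  using \<open>d \<in> X\<close>
proof (induction n arbitrary: d u)
  case 0
  then show ?case using V0 by simp
next
  case (Suc n)
  have "(\<Sum>k<Suc n. S d k u) = S d 0 u + (\<Sum>d'\<in>X. p d' d * (\<Sum>k<n. S d' k (H d u)))"
    unfolding sum.lessThan_Suc_shift step[OF Suc.prems] by (simp add: sum_distrib_left sum.swap[of _ X])
  also have "\<dots> \<le> S d 0 u + (\<Sum>d'\<in>X. p d' d * V d' (H d u))"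
    by (intro add_left_mono sum_mono mult_left_mono Suc.IH p)
  also have "\<dots> \<le> V d u" using base Suc.prems by simp
  finally show ?case .
qed

text \<open>In \<open>ennreal\<close> the finite sums can be exchanged with the series without a
  convergence proof, so real bounds on partial sums suffice.\<close>

lemma suminf_weighted_ennreal_le:
  fixes b :: "'i \<Rightarrow> 'c \<Rightarrow> nat \<Rightarrow> real"
  assumes "\<And>c. c \<in> X \<Longrightarrow> \<mu> c \<ge> 0" "\<And>i c k. c \<in> X \<Longrightarrow> b i c k \<ge> 0"
    and le: "\<And>n. (\<Sum>k<n. \<Sum>i\<in>I. \<Sum>c\<in>X. \<mu> c * b i c k) \<le> B"
  shows "(\<Sum>i\<in>I. \<Sum>c\<in>X. ennreal (\<mu> c) * (\<Sum>k. ennreal (b i c k))) \<le> ennreal B"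
proof -
  have "(\<Sum>i\<in>I. \<Sum>c\<in>X. ennreal (\<mu> c) * (\<Sum>k. ennreal (b i c k))) =
      (\<Sum>k. \<Sum>i\<in>I. \<Sum>c\<in>X. ennreal (\<mu> c) * ennreal (b i c k))"
    by (simp add: suminf_sum ennreal_suminf_cmult)
  also have "\<dots> = (\<Sum>k. ennreal (\<Sum>i\<in>I. \<Sum>c\<in>X. \<mu> c * b i c k))"
    using assms(1,2) by (simp add: sum_nonneg flip: sum_ennreal ennreal_mult)
  also have "\<dots> \<le> ennreal B"
  proof (rule suminf_le_const)
    fix n
    have "(\<Sum>k<n. ennreal (\<Sum>i\<in>I. \<Sum>c\<in>X. \<mu> c * b i c k)) =
        ennreal (\<Sum>k<n. \<Sum>i\<in>I. \<Sum>c\<in>X. \<mu> c * b i c k)"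
      using assms(1,2) by (intro sum_ennreal sum_nonneg mult_nonneg_nonneg) auto
    then show "(\<Sum>k<n. ennreal (\<Sum>i\<in>I. \<Sum>c\<in>X. \<mu> c * b i c k)) \<le> ennreal B"
      using le[of n] by (simp add: ennreal_leI)
  qed simp
  finally show ?thesis .
qed

theorem theorem4p2:
  fixes A :: "'r::finite \<Rightarrow> real^'n^'n"
    and B :: "'r \<Rightarrow> real^'m^'n"
    and C :: "'r \<Rightarrow> real^'n^'l"
    and D :: "'r \<Rightarrow> real^'m^'l"
    and E :: "'r \<Rightarrow> real^'q^'n"
    and P :: "real^'r^'r" and Q :: "real^'s^'s"
    and f :: "'s::finite \<Rightarrow> bool" and T :: nat
    and \<mu>r :: "'r pmf" and \<mu>s :: "'s pmf"
    and Pr :: "('r, 's) ext_mode \<Rightarrow> 'w measure"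
    and r :: "nat \<Rightarrow> 'w \<Rightarrow> 'r" and s :: "nat \<Rightarrow> 'w \<Rightarrow> 's"
    and \<tau>0 :: "('r, 's) ext_mode \<Rightarrow> int"
    and g :: real
    and W :: "('r, 's) ext_mode \<Rightarrow> real^'l^'l"
    and R :: "('r, 's) ext_mode \<Rightarrow> real^'n^'n"
    and F :: "'r \<Rightarrow> nat \<Rightarrow> real^'n^'m"
    and G :: "'r \<Rightarrow> nat \<Rightarrow> real^'n^'n"
    and \<nu> :: "'r \<Rightarrow> nat \<Rightarrow> real"
    and K :: "'r \<Rightarrow> nat \<Rightarrow> real^'n^'m"
  assumes "T > 0" and "stochastic P" and "stochastic Q"
    and "\<And>c. c \<in> ext_modes f T \<Longrightarrow> realization f T P Q (Pr c) r s (\<tau>0 c) c"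
    and "g > 0"
    and "\<And>\<gamma> \<delta>. \<delta> \<in> {1..T} \<Longrightarrow> \<nu> \<gamma> \<delta> \<ge> 0"
    and "\<And>\<alpha> \<beta> \<gamma> \<delta>. (\<alpha>, \<beta>, \<gamma>, \<delta>) \<in> ext_modes f T \<Longrightarrow>
           pos_def (sym_block
             (R (\<alpha>, \<beta>, \<gamma>, \<delta>) - ext_init f \<mu>r \<mu>s \<nu> (\<alpha>, \<beta>, \<gamma>, \<delta>) *\<^sub>R (E \<alpha> ** transpose (E \<alpha>)))
             (A \<alpha> ** G \<gamma> \<delta> + B \<alpha> ** F \<gamma> \<delta>)
             (G \<gamma> \<delta> + transpose (G \<gamma> \<delta>) - ext_D f T P Q R (\<alpha>, \<beta>, \<gamma>, \<delta>)))"
    and "\<And>\<alpha> \<beta> \<gamma> \<delta>. (\<alpha>, \<beta>, \<gamma>, \<delta>) \<in> ext_modes f T \<Longrightarrow>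
           pos_def (sym_block
             (W (\<alpha>, \<beta>, \<gamma>, \<delta>))
             (C \<alpha> ** G \<gamma> \<delta> + D \<alpha> ** F \<gamma> \<delta>)
             (G \<gamma> \<delta> + transpose (G \<gamma> \<delta>) - ext_D f T P Q R (\<alpha>, \<beta>, \<gamma>, \<delta>)))"
    and "(\<Sum>c\<in>ext_modes f T. trace (W c)) < g"
    and "(\<Sum>\<gamma>\<in>UNIV. \<Sum>\<delta>\<in>{1..T}. \<nu> \<gamma> \<delta>) = 1"
    and "\<And>\<alpha> \<beta> \<gamma> \<delta>. (\<alpha>, \<beta>, \<gamma>, \<delta>) \<in> ext_modes f T \<Longrightarrow>
           K \<gamma> \<delta> = F \<gamma> \<delta> ** matrix_inv (G \<gamma> \<delta>)"
  shows "mean_square_stable A B E K f T Pr r s \<tau>0 \<and>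
         (H2_norm A B C D E K f T Pr r s \<tau>0 (ext_init f \<mu>r \<mu>s \<nu>))\<^sup>2 < ennreal g"
proof -
  define X where "X = (ext_modes f T :: ('r, 's) ext_mode set)"
  define p where "p = ext_trans f T P Q"
  define \<mu> where "\<mu> = ext_init f \<mu>r \<mu>s \<nu>"
  define V where "V d u = u \<bullet> (R d *v u)" for d u
  define H where "H d u = transpose (closed_mat A B K d) *v u" for d :: "('r, 's) ext_mode" and u
  define Hz where "Hz d u = transpose (closed_mat C D K d) *v u" for d :: "('r, 's) ext_mode" and u
  define q where "q d u = (\<Sum>d'\<in>X. p d' d * V d' u)" for d u
  define \<gamma> where "\<gamma> d = fst (snd (snd d))" for d :: "('r, 's) ext_mode"
  define \<delta> where "\<delta> d = snd (snd (snd d))" for d :: "('r, 's) ext_mode"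
  have lmiR: "pos_def (sym_block
      (R d - \<mu> d *\<^sub>R (E (fst d) ** transpose (E (fst d))))
      (A (fst d) ** G (\<gamma> d) (\<delta> d) + B (fst d) ** F (\<gamma> d) (\<delta> d))
      (G (\<gamma> d) (\<delta> d) + transpose (G (\<gamma> d) (\<delta> d)) - ext_D f T P Q R d))" if "d \<in> X" for d
    using that assms(7) by (cases d) (simp only: X_def \<mu>_def \<gamma>_def \<delta>_def fst_conv snd_conv)
  have lmiW: "pos_def (sym_block (W d)
      (C (fst d) ** G (\<gamma> d) (\<delta> d) + D (fst d) ** F (\<gamma> d) (\<delta> d))
      (G (\<gamma> d) (\<delta> d) + transpose (G (\<gamma> d) (\<delta> d)) - ext_D f T P Q R d))" if "d \<in> X" for d
    using that assms(8) by (cases d) (simp only: X_def \<gamma>_def \<delta>_def fst_conv snd_conv)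
  have gain: "K (\<gamma> d) (\<delta> d) = F (\<gamma> d) (\<delta> d) ** matrix_inv (G (\<gamma> d) (\<delta> d))" if "d \<in> X" for d
    using that assms(11) by (cases d) (simp only: X_def \<gamma>_def \<delta>_def fst_conv snd_conv)
  have H_eq: "H d u = transpose (A (fst d) + B (fst d) ** K (\<gamma> d) (\<delta> d)) *v u"
    and Hz_eq: "Hz d v = transpose (C (fst d) + D (fst d) ** K (\<gamma> d) (\<delta> d)) *v v" for d u v
    unfolding H_def Hz_def \<gamma>_def \<delta>_def by (cases d; simp)+
  have finX: "finite X" by (simp add: X_def finite_ext_modes)
  have p: "p d' d \<ge> 0" for d d'
    unfolding p_def by (intro ext_trans_nonneg assms)
  have \<mu>: "\<mu> d \<ge> 0" if "d \<in> X" for d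
    using that assms(6) by (cases d) (auto simp: \<mu>_def X_def ext_modes_def)
  have EE: "u \<bullet> ((E \<alpha> ** transpose (E \<alpha>)) *v u) = (norm (transpose (E \<alpha>) *v u))\<^sup>2" for u \<alpha>
    by (simp add: power2_norm_eq_inner inner_transpose_mult flip: matrix_vector_mul_assoc)
  have S_form: "u \<bullet> ((R d - \<mu> d *\<^sub>R (E (fst d) ** transpose (E (fst d)))) *v u) =
      V d u - \<mu> d * (norm (transpose (E (fst d)) *v u))\<^sup>2" for d u
    by (simp add: V_def matrix_vector_mult_diff_rdistrib inner_diff_right EE flip: scaleR_matrix_vector_assoc)
  \<comment> \<open>Testing the first block matrix on (u, 0) gives positivity even after the
    positive semidefinite impulse term is subtracted.\<close>
  have V_pos: "V d u > 0" if "d \<in> X" "u \<noteq> 0" for d u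
  proof -
    have "V d u - \<mu> d * (norm (transpose (E (fst d)) *v u))\<^sup>2 > 0"
      using pos_def_sym_block[OF lmiR[OF that(1)], of u 0] that(2) unfolding S_form by simp
    then show ?thesis using \<mu>[OF that(1)] by (smt (verit) mult_nonneg_nonneg zero_le_power2)
  qed
  have V_nonneg: "V d u \<ge> 0" if "d \<in> X" for d u
    using V_pos[OF that, of u] by (cases "u = 0") (auto simp: V_def)
  have q_form: "q d u = u \<bullet> (ext_D f T P Q R d *v u)" for d u
    by (simp add: q_def ext_D_quadratic_form p_def X_def V_def)
  have D_nonneg: "u \<bullet> (ext_D f T P Q R d *v u) \<ge> 0" for d u
    unfolding q_form[symmetric] q_def by (intro sum_nonneg mult_nonneg_nonneg p V_nonneg)
  have gainR: "q d (H d u) + \<mu> d * (norm (transpose (E (fst d)) *v u))\<^sup>2 < V d u"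
    if "d \<in> X" "u \<noteq> 0" for d u
    using pos_def_sym_block_gain[OF lmiR[OF that(1)] D_nonneg gain[OF that(1)] that(2)]
    unfolding S_form q_form H_eq by simp
  \<comment> \<open>The weak form also admits \<open>u = 0\<close>, where both sides vanish; images
    under \<open>H d\<close> can be zero.\<close>
  have gainR': "q d (H d u) + \<mu> d * (norm (transpose (E (fst d)) *v u))\<^sup>2 \<le> V d u" if "d \<in> X" for d u
    using gainR[OF that, of u] by (cases "u = 0") (auto simp: V_def H_def q_def)
  have gainW: "q d (Hz d u) \<le> u \<bullet> (W d *v u)" if "d \<in> X" "u \<noteq> 0" for d u
    using pos_def_sym_block_gain[OF lmiW[OF that(1)] D_nonneg gain[OF that(1)] that(2)]
    unfolding q_form Hz_eq by simp
  have loop: "realized_loop f T P Q (Pr c) r s \<tau>0 c w" if "c \<in> X" "\<And>k. k > 0 \<Longrightarrow> w k = 0" for c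
    and w :: "nat \<Rightarrow> real^'q"
    using that assms(1,4) by unfold_locales (auto simp: X_def)

  \<comment> \<open>Mean square stability\<close>
  have "mean_square_stable A B E K f T Pr r s \<tau>0"
  proof -
    have "\<exists>\<kappa>\<in>{0..<1}. \<forall>u. q d (H d u) \<le> \<kappa> * V d u" if d: "d \<in> X" for d
    proof (rule quadratic_contraction)
      show "continuous_on UNIV (\<lambda>u. q d (H d u))"
        unfolding q_form H_def by (rule continuous_on_quadratic_form)
      show "continuous_on UNIV (V d)"
        using continuous_on_quadratic_form[of UNIV "mat 1" "R d"] by (simp add: V_def)
      show "q d (H d (t *\<^sub>R u)) = t\<^sup>2 * q d (H d u)" for t u
        by (simp add: q_form H_def matrix_vector_mult_scaleR power2_eq_square del: transpose_matrix_vector)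
      show "V d (t *\<^sub>R u) = t\<^sup>2 * V d u" for t u unfolding V_def by (rule quadratic_form_scaleR)
      show "V d u > 0" if "u \<noteq> 0" for u using V_pos[OF d that] .
      show "q d (H d u) < V d u" if "u \<noteq> 0" for u
        using gainR[OF d that] \<mu>[OF d] by (smt (verit) mult_nonneg_nonneg zero_le_power2)
    qed
    then obtain \<kappa>0 where \<kappa>0: "\<kappa>0 d \<in> {0..<1}" "q d (H d u) \<le> \<kappa>0 d * V d u" if "d \<in> X" for d u
      by metis
    \<comment> \<open>The bound 1/2 keeps \<open>\<kappa>\<close> away from 0, since the time shift in \<^const>\<open>second_moment\<close> costs a factor 1/\<open>\<kappa>\<close>.\<close>
    define \<kappa> where "\<kappa> = Max (insert (1/2) (\<kappa>0 ` X))"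
    have "\<kappa> \<in> insert (1/2) (\<kappa>0 ` X)" unfolding \<kappa>_def using finX by (intro Max_in) auto
    then have \<kappa>1: "\<kappa> < 1" using \<kappa>0(1) by fastforce
    have \<kappa>_half: "\<kappa> \<ge> 1/2" unfolding \<kappa>_def using finX by (intro Max_ge) auto
    have \<kappa>: "q d (H d u) \<le> \<kappa> * V d u" if "d \<in> X" for d u
    proof -
      have "\<kappa>0 d \<le> \<kappa>" unfolding \<kappa>_def using finX that by (intro Max_ge) auto
      then show ?thesis using \<kappa>0(2)[OF that, of u] V_nonneg[OF that, of u] by (meson mult_right_mono order_trans)
    qed
    have "\<exists>C>0. \<forall>u. (norm u)\<^sup>2 \<le> C * V d u" if "d \<in> X" for d
    proof (rule quadratic_coercive)
      show "continuous_on UNIV (V d)"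
        using continuous_on_quadratic_form[of UNIV "mat 1" "R d"] by (simp add: V_def)
      show "V d (t *\<^sub>R u) = t\<^sup>2 * V d u" for t u unfolding V_def by (rule quadratic_form_scaleR)
      show "V d u > 0" if "u \<noteq> 0" for u using V_pos[OF \<open>d \<in> X\<close> that] .
    qed
    then obtain C0 where C0: "C0 d > 0" "(norm u)\<^sup>2 \<le> C0 d * V d u" if "d \<in> X" for d u
      by metis
    define C1 where "C1 = (\<Sum>d\<in>X. C0 d)"
    have C1: "(norm u)\<^sup>2 \<le> C1 * V d u" if "d \<in> X" for d u
    proof -
      have "C0 d \<le> C1" unfolding C1_def using that C0(1) finX by (intro member_le_sum) (auto intro: less_imp_le)
      then show ?thesis using C0(2)[OF that, of u] V_nonneg[OF that, of u] by (meson mult_right_mono order_trans)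
    qed
    have C1_nonneg: "C1 \<ge> 0" unfolding C1_def using C0(1) by (intro sum_nonneg) (auto intro: less_imp_le)
    define L where "L = (\<Sum>d\<in>X. (onorm ((*v) (closed_mat A B K d)))\<^sup>2)"
    have L_nonneg: "L \<ge> 0" unfolding L_def by (intro sum_nonneg) auto
    have L: "(norm (closed_mat A B K d *v x))\<^sup>2 \<le> L * (norm x)\<^sup>2" if "d \<in> X" for d x
    proof -
      have "(norm (closed_mat A B K d *v x))\<^sup>2 \<le> (onorm ((*v) (closed_mat A B K d)) * norm x)\<^sup>2"
        by (intro power_mono onorm matrix_vector_mul_bounded_linear) simp
      also have "\<dots> \<le> L * (norm x)\<^sup>2"
        unfolding power_mult_distrib L_def using that finX
        by (intro mult_right_mono member_le_sum[where f = "\<lambda>d. (onorm ((*v) (closed_mat A B K d)))\<^sup>2"]) auto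
      finally show ?thesis .
    qed
    define tr where "tr = (\<Sum>d\<in>X. \<Sum>j\<in>UNIV. V d (axis j 1))"
    have tr_nonneg: "tr \<ge> 0" unfolding tr_def by (intro sum_nonneg V_nonneg)
    \<comment> \<open>The summand 1 settles \<open>k = 0\<close>. In the other one,
      \<open>C1 * L\<close> bounds the first second moment relative to \<open>V\<close>,
      \<open>tr\<close> comes from summing over modes and coordinates, and 2 pays for the time
      shift.\<close>
    define C' where "C' = 1 + 2 * C1 * L * tr"
    have C'_pos: "C' > 0" unfolding C'_def using C1_nonneg L_nonneg tr_nonneg by (simp add: add_pos_nonneg)
    have "mean_square (Pr c) (cl_state A B E K f T r s \<tau>0 x0 c (\<lambda>_. 0) k)
          \<le> ennreal (C' * \<kappa> ^ k * (norm x0)\<^sup>2)" if cX: "c \<in> X" for x0 c k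
    proof -
      interpret realized_loop f T P Q "Pr c" r s \<tau>0 c A B E K x0 "\<lambda>_. 0"
        by (rule loop[OF cX]) simp
      show ?thesis
      proof (cases k)
        case 0
        have "(norm x0)\<^sup>2 \<le> C' * (norm x0)\<^sup>2"
          unfolding C'_def using C1_nonneg L_nonneg tr_nonneg by (simp add: distrib_right)
        then show ?thesis unfolding 0 mean_square_cl_state_0 by (simp add: ennreal_leI)
      next
        case (Suc k')
        let ?S = "second_moment (Pr c) mode state"
        define b where "b = C1 * L * (norm x0)\<^sup>2"
        have b: "b \<ge> 0" unfolding b_def using C1_nonneg L_nonneg by simp
        have "?S d k' u \<le> b * \<kappa> ^ k' * V d u" if "d \<in> X" for d u
        proof (rule transfer_decay[where p = p and H = H and X = X and V = V])
          show "?S d 0 u \<le> b * V d u" if d: "d \<in> X" for d u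
          proof -
            have "?S d 0 u \<le> (u \<bullet> (closed_mat A B K c *v x0))\<^sup>2"
              unfolding second_moment_0 by simp
            also have "\<dots> \<le> (norm u * norm (closed_mat A B K c *v x0))\<^sup>2"
              by (rule power2_le_iff_abs_le[THEN iffD2]) (simp_all add: Cauchy_Schwarz_ineq2)
            also have "\<dots> \<le> (C1 * V d u) * (L * (norm x0)\<^sup>2)"
              unfolding power_mult_distrib using C1_nonneg V_nonneg[OF d]
              by (intro mult_mono C1[OF d] L[OF cX]) simp_all
            finally show ?thesis by (simp add: b_def mult_ac)
          qed
          show "?S d (Suc k) u = (\<Sum>d'\<in>X. p d' d * ?S d' k (H d u))" if "d \<in> X" for d k u
            using that unfolding X_def p_def H_def by (rule second_moment_Suc)
          show "(\<Sum>d'\<in>X. p d' d * V d' (H d u)) \<le> \<kappa> * V d u" if "d \<in> X" for d u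
            using \<kappa>[OF that] by (simp add: q_def)
        qed (use p b \<kappa>_half that in auto)
        then have "(\<Sum>d\<in>X. \<Sum>j\<in>UNIV. ?S d k' (axis j 1)) \<le> (\<Sum>d\<in>X. \<Sum>j\<in>UNIV. b * \<kappa> ^ k' * V d (axis j 1))"
          by (intro sum_mono)
        also have "\<dots> = b * tr * \<kappa> ^ k'" by (simp add: tr_def sum_distrib_left mult_ac)
        \<comment> \<open>Here \<open>k = Suc k'\<close>, and \<open>\<kappa> \<ge> 1/2\<close>
          gives \<open>\<kappa> ^ k' \<le> 2 * \<kappa> ^ k\<close>.\<close>
        also have "\<dots> \<le> b * tr * (2 * \<kappa> ^ k)"
          unfolding Suc using b tr_nonneg \<kappa>_half by (intro mult_left_mono) auto
        also have "\<dots> \<le> C' * \<kappa> ^ k * (norm x0)\<^sup>2"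
          using \<kappa>_half unfolding b_def C'_def by (simp add: algebra_simps)
        finally show ?thesis
          unfolding Suc mean_square_cl_state_Suc X_def[symmetric] by (rule ennreal_leI)
      qed
    qed
    moreover have "\<kappa> \<in> {0..<1}" using \<kappa>1 \<kappa>_half by simp
    ultimately show ?thesis
      unfolding mean_square_stable_def X_def[symmetric] using C'_pos by blast
  qed

  \<comment> \<open>Bound on the squared \<open>H\<^sub>2\<close> norm\<close>
  moreover have "(H2_norm A B C D E K f T Pr r s \<tau>0 \<mu>)\<^sup>2 \<le> ennreal (\<Sum>c\<in>X. trace (W c))"
  proof -
    \<comment> \<open>The path functional is written with its locale parameters because the input
      direction and the initial mode vary; the locale is interpreted anew for each pair.\<close>
    define S where "S i c = second_moment (Pr c)
      (\<lambda>k \<omega>. ext_path f T c (\<lambda>i. r i \<omega>) (\<lambda>i. s i \<omega>) k)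
      (\<lambda>k \<omega>. realized_loop.path_state f T c A B E K 0 (unit_impulse i) (\<lambda>i. r i \<omega>) (\<lambda>i. s i \<omega>) k)"
      for i :: 'q and c
    define Z where "Z i c k = (\<Sum>d\<in>X. \<Sum>j\<in>UNIV. \<Sum>d'\<in>X. p d' d * S i c d' k (Hz d (axis j 1)))" for i c k
    define z where "z i c = cl_output A B C D E K f T r s \<tau>0 0 c (unit_impulse i)" for i c
    have S_0: "S i c d 0 u = (u \<bullet> (E (fst c) *v axis i 1))\<^sup>2 * of_bool (c = d)" if "c \<in> X" for i c d u
    proof -
      interpret realized_loop f T P Q "Pr c" r s \<tau>0 c A B E K 0 "unit_impulse i"
        by (rule loop[OF that]) (simp add: unit_impulse_def)
      show ?thesis unfolding S_def second_moment_0 by (simp add: unit_impulse_def)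
    qed
    have S_Suc: "S i c d (Suc k) u = (\<Sum>d'\<in>X. p d' d * S i c d' k (H d u))" if "c \<in> X" "d \<in> X" for i c d k u
    proof -
      interpret realized_loop f T P Q "Pr c" r s \<tau>0 c A B E K 0 "unit_impulse i"
        by (rule loop[OF that(1)]) (simp add: unit_impulse_def)
      show ?thesis using that(2) unfolding S_def X_def p_def H_def by (rule second_moment_Suc)
    qed
    have Z: "mean_square (Pr c) (z i c (Suc k)) = ennreal (Z i c k)" "Z i c k \<ge> 0" if "c \<in> X" for i c k
    proof -
      interpret realized_loop f T P Q "Pr c" r s \<tau>0 c A B E K 0 "unit_impulse i"
        by (rule loop[OF that(1)]) (simp add: unit_impulse_def)
      show "mean_square (Pr c) (z i c (Suc k)) = ennreal (Z i c k)" "Z i c k \<ge> 0"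
        unfolding z_def Z_def S_def X_def p_def Hz_def by (rule mean_square_cl_output_Suc)+
    qed
    have z_0: "mean_square (Pr c) (z i c 0) = 0" for i c
      by (simp add: z_def mean_square_def cl_output_eq cl_state_eq)
    \<comment> \<open>Averaging over initial modes and summing over inputs commutes with the linear
      recursion, and it makes the initial form exactly the forcing term of the first matrix
      inequality.\<close>
    define Y where "Y d k u = (\<Sum>i\<in>UNIV. \<Sum>c\<in>X. \<mu> c * S i c d k u)" for d k u
    have Y_0: "Y d 0 u = \<mu> d * (norm (transpose (E (fst d)) *v u))\<^sup>2" if "d \<in> X" for d u
    proof -
      have "Y d 0 u = (\<Sum>i\<in>UNIV. \<Sum>c\<in>X. if d = c then \<mu> d * (u \<bullet> (E (fst d) *v axis i 1))\<^sup>2 else 0)"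
        unfolding Y_def by (intro sum.cong refl) (auto simp: S_0)
      also have "\<dots> = \<mu> d * (\<Sum>i\<in>UNIV. (axis i 1 \<bullet> (transpose (E (fst d)) *v u))\<^sup>2)"
      proof -
        have "u \<bullet> (E (fst d) *v axis i 1) = axis i 1 \<bullet> (transpose (E (fst d)) *v u)" for i
          by (metis inner_transpose_mult inner_commute)
        then show ?thesis using that finX by (simp add: sum_distrib_left del: transpose_matrix_vector)
      qed
      finally show ?thesis unfolding norm_sq_eq_sum_axis .
    qed
    have Y_Suc: "Y d (Suc k) u = (\<Sum>d'\<in>X. p d' d * Y d' k (H d u))" if "d \<in> X" for d k u
    proof -
      have "Y d (Suc k) u = (\<Sum>i\<in>UNIV. \<Sum>c\<in>X. \<Sum>d'\<in>X. p d' d * (\<mu> c * S i c d' k (H d u)))"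
        unfolding Y_def by (intro sum.cong refl) (simp add: S_Suc that sum_distrib_left mult_ac)
      also have "\<dots> = (\<Sum>i\<in>UNIV. \<Sum>d'\<in>X. \<Sum>c\<in>X. p d' d * (\<mu> c * S i c d' k (H d u)))"
        by (intro sum.cong refl sum.swap)
      also have "\<dots> = (\<Sum>d'\<in>X. \<Sum>i\<in>UNIV. \<Sum>c\<in>X. p d' d * (\<mu> c * S i c d' k (H d u)))"
        by (rule sum.swap)
      finally show ?thesis by (simp add: Y_def sum_distrib_left)
    qed
    have Y_sum: "(\<Sum>k<n. Y d k u) \<le> V d u" if "d \<in> X" for d u n
      using p V_nonneg _ Y_Suc that
    proof (rule transfer_partial_sums_le)
      show "Y d 0 u + (\<Sum>d'\<in>X. p d' d * V d' (H d u)) \<le> V d u" if "d \<in> X" for d u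
        using gainR'[OF that, of u] by (simp add: Y_0[OF that] q_def)
    qed
    have Z_sum: "(\<Sum>k<n. \<Sum>i\<in>UNIV. \<Sum>c\<in>X. \<mu> c * Z i c k) \<le> (\<Sum>c\<in>X. trace (W c))" for n
    proof -
      have "(\<Sum>i\<in>UNIV. \<Sum>c\<in>X. \<mu> c * Z i c k) =
          (\<Sum>d\<in>X. \<Sum>j\<in>UNIV. \<Sum>d'\<in>X. p d' d * Y d' k (Hz d (axis j 1)))" for k
      proof -
        have "(\<Sum>i\<in>UNIV. \<Sum>c\<in>X. \<mu> c * Z i c k) =
          (\<Sum>(i, c)\<in>UNIV \<times> X. \<Sum>(d, j, d')\<in>X \<times> UNIV \<times> X. p d' d * (\<mu> c * S i c d' k (Hz d (axis j 1))))"
          by (simp add: Z_def sum.cartesian_product[symmetric] sum_distrib_left mult_ac)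
        also have "\<dots> = (\<Sum>(d, j, d')\<in>X \<times> UNIV \<times> X. \<Sum>(i, c)\<in>UNIV \<times> X. p d' d * (\<mu> c * S i c d' k (Hz d (axis j 1))))"
          unfolding case_prod_beta by (rule sum.swap)
        finally show ?thesis
          by (simp add: Y_def sum.cartesian_product[symmetric] sum_distrib_left)
      qed
      then have "(\<Sum>k<n. \<Sum>i\<in>UNIV. \<Sum>c\<in>X. \<mu> c * Z i c k) =
          (\<Sum>k<n. \<Sum>(d, j, d')\<in>X \<times> UNIV \<times> X. p d' d * Y d' k (Hz d (axis j 1)))"
        by (simp add: sum.cartesian_product[symmetric])
      also have "\<dots> = (\<Sum>(d, j, d')\<in>X \<times> UNIV \<times> X. \<Sum>k<n. p d' d * Y d' k (Hz d (axis j 1)))"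
        unfolding case_prod_beta by (rule sum.swap)
      also have "\<dots> = (\<Sum>d\<in>X. \<Sum>j\<in>UNIV. \<Sum>d'\<in>X. p d' d * (\<Sum>k<n. Y d' k (Hz d (axis j 1))))"
        by (simp add: sum.cartesian_product[symmetric] sum_distrib_left)
      also have "\<dots> \<le> (\<Sum>d\<in>X. \<Sum>j\<in>UNIV. q d (Hz d (axis j 1)))"
        unfolding q_def by (intro sum_mono mult_left_mono Y_sum p)
      \<comment> \<open>The second matrix inequality is used only on the unit vectors, whose
        quadratic forms add up to the trace.\<close>
      also have "\<dots> \<le> (\<Sum>d\<in>X. trace (W d))"
        unfolding trace_eq_quadratic_form_sum by (intro sum_mono gainW) (simp_all add: axis_eq_0_iff)
      finally show ?thesis .
    qed
    \<comment> \<open>\<open>Z\<close> is indexed from time 1. The output at time 0 is zero because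
      the state starts at the origin and the impulse does not act on the output directly.\<close>
    define b where "b i c k = (case k of 0 \<Rightarrow> 0 | Suc k' \<Rightarrow> Z i c k')" for i c k
    have b: "mean_square (Pr c) (z i c k) = ennreal (b i c k)" "b i c k \<ge> 0" if "c \<in> X" for i c k
      using Z[OF that] z_0 by (simp_all add: b_def split: nat.split)
    have "(H2_norm A B C D E K f T Pr r s \<tau>0 \<mu>)\<^sup>2 =
        (\<Sum>i\<in>UNIV. \<Sum>c\<in>X. ennreal (\<mu> c) * (\<Sum>k. mean_square (Pr c) (z i c k)))"
      by (simp add: H2_norm_def l2_norm_def ennreal_sqrt_power2 X_def z_def)
    also have "\<dots> = (\<Sum>i\<in>UNIV. \<Sum>c\<in>X. ennreal (\<mu> c) * (\<Sum>k. ennreal (b i c k)))"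
      by (intro sum.cong refl arg_cong2[where f = "(*)"] suminf_cong b(1))
    also have "\<dots> \<le> ennreal (\<Sum>c\<in>X. trace (W c))"
    proof (rule suminf_weighted_ennreal_le)
      show "(\<Sum>k<n. \<Sum>i\<in>UNIV. \<Sum>c\<in>X. \<mu> c * b i c k) \<le> (\<Sum>c\<in>X. trace (W c))" for n
      proof (cases n)
        case 0
        then show ?thesis using Z_sum[of 0] by simp
      next
        case (Suc m)
        then show ?thesis using Z_sum[of m] by (simp add: sum.lessThan_Suc_shift b_def del: sum.lessThan_Suc)
      qed
    qed (use \<mu> b in auto)
    finally show ?thesis .
  qed
  \<comment> \<open>Positivity of \<open>g\<close> keeps the inequality strict under the truncation
    by \<open>ennreal\<close>.\<close>
  moreover have "ennreal (\<Sum>c\<in>X. trace (W c)) < ennreal g"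
    using assms(5,9) by (simp add: X_def ennreal_lessI)
  ultimately show ?thesis unfolding \<mu>_def by (auto intro: order_le_less_trans)
qed

end
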